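(* Let $G$ be a finite simple partial $2$-tree with maximum degree at most $4$, let $V'$ be the set of vertices of degree $2$ in $G$, and let $\mathcal{S}=\{S_1,\dots,S_m\}$ be any collection of pairwise disjoint subsets of $V'$, each of size $2$. Then $G$ has a $2$-linear coloring satisfying $\mathcal{S}$, i.e. a $2$-linear coloring in which, for each $i\in\{1,\dots,m\}$, at most one of the two vertices of $S_i$ is monochromatic.
   Context: A partial $2$-tree is a graph admitting a tree decomposition of width at most $2$ (treewidth at most $2$). A linear forest is a forest each of whose components is a path. A $2$-linear coloring of $G$ is a map $c:E(G)\to\{1,2\}$ such that each color class forms a linear forest. Given a $2$-linear coloring of $G$, a vertex is called monochromatic if it has degree exactly $2$ in $G$ and both edges incident with it receive the same color. *)

theory Defs
  imports Main
begin

definition simple_graph :: "'a set \<Rightarrow> 'a set set \<Rightarrow> bool" where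
  "simple_graph V E \<longleftrightarrow> (\<forall>e\<in>E. e \<subseteq> V \<and> card e = 2)"

definition degree :: "'a set set \<Rightarrow> 'a \<Rightarrow> nat" where
  "degree E v = card {e \<in> E. v \<in> e}"

definition adj :: "'a set set \<Rightarrow> ('a \<times> 'a) set" where
  "adj E = {(u, v). {u, v} \<in> E}"

definition induced_edges :: "'a set set \<Rightarrow> 'a set \<Rightarrow> 'a set set" where
  "induced_edges E W = {e \<in> E. e \<subseteq> W}"

definition connected_graph :: "'a set \<Rightarrow> 'a set set \<Rightarrow> bool" where
  "connected_graph V E \<longleftrightarrow> V \<noteq> {} \<and> (\<forall>u\<in>V. \<forall>v\<in>V. (u, v) \<in> (adj E)\<^sup>*)"

text \<open>A cycle is given by the list of its vertices in cyclic order, each listed once.\<close>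

definition is_cycle :: "'a set set \<Rightarrow> 'a list \<Rightarrow> bool" where
  "is_cycle E xs \<longleftrightarrow> 3 \<le> length xs \<and> distinct xs \<and>
     (\<forall>i < length xs. {xs ! i, xs ! (Suc i mod length xs)} \<in> E)"

definition forest :: "'a set \<Rightarrow> 'a set set \<Rightarrow> bool" where
  "forest V E \<longleftrightarrow> simple_graph V E \<and> (\<nexists>xs. is_cycle E xs)"

definition tree :: "'a set \<Rightarrow> 'a set set \<Rightarrow> bool" where
  "tree V E \<longleftrightarrow> forest V E \<and> connected_graph V E"

text \<open>A single vertex without edges counts as a path.\<close>

definition path_graph :: "'a set \<Rightarrow> 'a set set \<Rightarrow> bool" where
  "path_graph V E \<longleftrightarrow> (\<exists>xs. xs \<noteq> [] \<and> distinct xs \<and> V = set xs \<and>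
     E = {{xs ! i, xs ! Suc i} | i. Suc i < length xs})"

definition components :: "'a set \<Rightarrow> 'a set set \<Rightarrow> 'a set set" where
  "components V E = {{u \<in> V. (v, u) \<in> (adj E)\<^sup>*} | v. v \<in> V}"

definition linear_forest :: "'a set \<Rightarrow> 'a set set \<Rightarrow> bool" where
  "linear_forest V E \<longleftrightarrow> forest V E \<and>
     (\<forall>C \<in> components V E. path_graph C (induced_edges E C))"

definition tree_decomposition ::
  "'a set \<Rightarrow> 'a set set \<Rightarrow> 't set \<Rightarrow> 't set set \<Rightarrow> ('t \<Rightarrow> 'a set) \<Rightarrow> bool" where
  "tree_decomposition V E T F bag \<longleftrightarrow>
     finite T \<and> tree T F \<and>
     (\<Union>t\<in>T. bag t) = V \<and>
     (\<forall>e\<in>E. \<exists>t\<in>T. e \<subseteq> bag t) \<and>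
     (\<forall>v\<in>V. connected_graph {t \<in> T. v \<in> bag t} (induced_edges F {t \<in> T. v \<in> bag t}))"

text \<open>The width is an integer because it equals -1 when all bags are empty.\<close>

definition decomposition_width :: "'t set \<Rightarrow> ('t \<Rightarrow> 'a set) \<Rightarrow> int" where
  "decomposition_width T bag = int (Max ((\<lambda>t. card (bag t)) ` T)) - 1"

text \<open>
  Decomposition trees are finite, so there is no loss in taking their nodes to be natural numbers.
\<close>

definition partial_2_tree :: "'a set \<Rightarrow> 'a set set \<Rightarrow> bool" where
  "partial_2_tree V E \<longleftrightarrow> (\<exists>(T :: nat set) F bag.
     tree_decomposition V E T F bag \<and> decomposition_width T bag \<le> 2)"

text \<open>Each color class is regarded as a spanning subgraph.\<close>

definition two_linear_coloring :: "'a set \<Rightarrow> 'a set set \<Rightarrow> ('a set \<Rightarrow> nat) \<Rightarrow> bool" where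
  "two_linear_coloring V E c \<longleftrightarrow> (\<forall>e\<in>E. c e \<in> {1, 2}) \<and>
     (\<forall>i\<in>{1, 2}. linear_forest V {e \<in> E. c e = i})"

definition monochromatic :: "'a set set \<Rightarrow> ('a set \<Rightarrow> nat) \<Rightarrow> 'a \<Rightarrow> bool" where
  "monochromatic E c v \<longleftrightarrow> degree E v = 2 \<and>
     (\<forall>e\<in>E. \<forall>f\<in>E. v \<in> e \<and> v \<in> f \<longrightarrow> c e = c f)"

definition satisfies :: "'a set set \<Rightarrow> ('a set \<Rightarrow> nat) \<Rightarrow> 'a set set \<Rightarrow> bool" where
  "satisfies E c \<S> \<longleftrightarrow> (\<forall>S\<in>\<S>. card {v \<in> S. monochromatic E c v} \<le> 1)"

end

theory Submission
  imports Defs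
begin

text \<open>
  Induction on the number of edges. A color class is handled as an acyclic edge set of maximum
  degree at most 2, and edges are only ever added to it at a vertex it does not yet meet. If
  neither a leaf nor an edge between two vertices of degree 2 exists, contract each vertex of
  degree 2 into a neighbour; a simplicial vertex of the contracted tree decomposition exhibits one
  of three configurations: a 4-cycle with two opposite vertices of degree 2, a triangle on vertices
  of degrees 2 and 3, or two triangles sharing a vertex of degree 4. In each case delete the
  edges of the configuration and color them again at the end. Deletion creates new vertices of
  degree 2 and leaves some vertices without their partner; pairing these suitably in the smaller
  graph rules out exactly the colorings that would not extend.
\<close>

section \<open>Linear forests\<close>

text \<open>The pairs in the statement are what lets the induction close. Suppose that in a square
  both \<open>x\<close> and \<open>y\<close> have degree 4, and that all edges left at them after
  the deletion have the same color. Then the four deleted edges are forced into the other color and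
  form a monochromatic 4-cycle. Excluding this needs control over \<open>x\<close> and
  \<open>y\<close> in the smaller graph; both have degree 2 there, so \<open>{x, y}\<close> can be
  made a pair. Conversely, a reinserted vertex of degree 2 cannot always be kept from becoming
  monochromatic, so the pairs of the smaller graph must also protect its former partner. Adding
  edges only at a vertex fresh for the color is what makes degrees sufficient information: no cycle
  can close, however the rest of the color class is connected. At a vertex with at most two old
  edges, either both colors have room for one more edge or one color is entirely fresh; the case
  distinctions below come from this.\<close>

lemma degree_insert:
  assumes "finite E" "e \<notin> E"
  shows "degree (insert e E) v = degree E v + (if v \<in> e then 1 else 0)"
proof -
  have "{f \<in> insert e E. v \<in> f} = (if v \<in> e then insert e {f \<in> E. v \<in> f} else {f \<in> E. v \<in> f})"
    by auto
  then show ?thesis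
    using assms by (simp add: degree_def)
qed

lemma degree_Un_disjoint:
  assumes "finite R" "finite B" "R \<inter> B = {}"
  shows "degree (R \<union> B) v = degree R v + degree B v"
proof -
  have "{e \<in> R \<union> B. v \<in> e} = {e \<in> R. v \<in> e} \<union> {e \<in> B. v \<in> e}"
    by auto
  then show ?thesis
    unfolding degree_def using assms by (subst card_Un_disjoint[symmetric]) auto
qed

lemma degree_eq_0_iff: "finite E \<Longrightarrow> degree E v = 0 \<longleftrightarrow> (\<forall>e\<in>E. v \<notin> e)"
  by (auto simp: degree_def)

lemma card_le_degree:
  assumes "finite E" "A \<subseteq> E" "\<forall>e\<in>A. v \<in> e"
  shows "card A \<le> degree E v"
  unfolding degree_def by (rule card_mono) (use assms in auto)

lemma degree_mono: "finite E \<Longrightarrow> E' \<subseteq> E \<Longrightarrow> degree E' v \<le> degree E v"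
  unfolding degree_def by (rule card_mono) auto

lemma is_cycle_mono: "is_cycle E xs \<Longrightarrow> E \<subseteq> E' \<Longrightarrow> is_cycle E' xs"
  by (auto simp: is_cycle_def)

lemma is_cycle_two_neighbours:
  assumes "is_cycle E xs" "v \<in> set xs"
  obtains a b where "a \<noteq> b" "{v, a} \<in> E" "{v, b} \<in> E"
proof -
  let ?n = "length xs"
  from assms have n: "3 \<le> ?n" and d: "distinct xs"
    and E: "\<And>i. i < ?n \<Longrightarrow> {xs ! i, xs ! (Suc i mod ?n)} \<in> E"
    by (auto simp: is_cycle_def)
  obtain i where i: "i < ?n" "v = xs ! i"
    using assms(2) by (auto simp: in_set_conv_nth)
  \<comment> \<open>The index of the cyclic predecessor. Length at least 3 makes it differ from that
    of the successor.\<close>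
  define j where "j = (if i = 0 then ?n - 1 else i - 1)"
  have j: "j < ?n" "Suc j mod ?n = i"
    using i n by (auto simp: j_def)
  have k: "Suc i mod ?n < ?n" "Suc i mod ?n \<noteq> j"
    using i n by (auto simp: j_def mod_if)
  show ?thesis
  proof (rule that)
    show "xs ! (Suc i mod ?n) \<noteq> xs ! j"
      using k j d by (simp add: nth_eq_iff_index_eq)
    show "{v, xs ! (Suc i mod ?n)} \<in> E" "{v, xs ! j} \<in> E"
      using E[OF i(1)] E[OF j(1)] i j by (simp_all add: insert_commute)
  qed
qed

text \<open>A linear forest expressed by its edges alone, which frees the induction from carrying a
  vertex set; \<open>lin_imp_linear_forest\<close> recovers the path components.\<close>

definition lin :: "'a set set \<Rightarrow> bool" where
  "lin E \<longleftrightarrow> finite E \<and> (\<forall>v. degree E v \<le> 2) \<and> (\<nexists>xs. is_cycle E xs)"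

text \<open>A cycle using the new edge would need two edges at \<open>v\<close>, which meets no
  other edge.\<close>

lemma lin_insert:
  assumes "lin R" "degree R v = 0" "degree R u \<le> 1" "u \<noteq> v"
  shows "lin (insert {u, v} R)"
proof -
  have fin: "finite R" and deg: "\<And>w. degree R w \<le> 2" and cyc: "\<And>xs. \<not> is_cycle R xs"
    using assms by (auto simp: lin_def)
  have v: "\<And>e. e \<in> R \<Longrightarrow> v \<notin> e"
    using fin assms(2) by (auto simp: degree_eq_0_iff)
  then have "{u, v} \<notin> R" by auto
  then have "degree (insert {u, v} R) w \<le> 2" for w
    using deg[of w] assms fin by (auto simp: degree_insert)
  moreover have "\<not> is_cycle (insert {u, v} R) xs" for xs
  proof
    assume c: "is_cycle (insert {u, v} R) xs"
    show False
    proof (cases "v \<in> set xs")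
      case True
      with c obtain a b where "a \<noteq> b" "{v, a} \<in> insert {u, v} R" "{v, b} \<in> insert {u, v} R"
        by (rule is_cycle_two_neighbours)
      then show False
        using v by (auto simp: doubleton_eq_iff)
    next
      case False
      have "is_cycle R xs"
        unfolding is_cycle_def
      proof (intro conjI allI impI)
        show "3 \<le> length xs" "distinct xs"
          using c by (auto simp: is_cycle_def)
        fix i assume i: "i < length xs"
        then have "{xs ! i, xs ! (Suc i mod length xs)} \<in> insert {u, v} R"
          using c by (auto simp: is_cycle_def)
        moreover have "xs ! i \<in> set xs" "xs ! (Suc i mod length xs) \<in> set xs"
          using i by (auto intro!: nth_mem mod_less_divisor)
        ultimately show "{xs ! i, xs ! (Suc i mod length xs)} \<in> R"
          using False by (auto simp: doubleton_eq_iff)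
      qed
      then show False using cyc by blast
    qed
  qed
  ultimately show ?thesis
    using fin by (auto simp: lin_def)
qed

section \<open>Maximal paths and the components of a linear forest\<close>

definition path :: "'a set set \<Rightarrow> 'a list \<Rightarrow> bool" where
  "path E xs \<longleftrightarrow> xs \<noteq> [] \<and> distinct xs \<and> (\<forall>i. Suc i < length xs \<longrightarrow> {xs ! i, xs ! Suc i} \<in> E)"

lemma path_Cons:
  assumes "path E xs" "u \<notin> set xs" "{u, xs ! 0} \<in> E"
  shows "path E (u # xs)"
  using assms by (auto simp: path_def nth_Cons split: nat.split)

lemma path_rev:
  assumes "path E xs"
  shows "path E (rev xs)"
  unfolding path_def
proof (intro conjI allI impI)
  show "rev xs \<noteq> []" "distinct (rev xs)"
    using assms by (auto simp: path_def)
  fix i assume i: "Suc i < length (rev xs)"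
  define j where "j = length xs - Suc (Suc i)"
  have "Suc j < length xs" "rev xs ! i = xs ! Suc j" "rev xs ! Suc i = xs ! j"
    using i by (auto simp: j_def rev_nth Suc_diff_Suc)
  then show "{rev xs ! i, rev xs ! Suc i} \<in> E"
    using assms by (auto simp: path_def insert_commute)
qed

text \<open>A longest path through \<open>x\<close> within \<open>V\<close>: a neighbour of an end
  outside the path would lengthen it, at the far end after reversal.\<close>

lemma maximal_path:
  assumes "finite V" "\<forall>e\<in>E. e \<subseteq> V" "x \<in> V"
  obtains xs where "path E xs" "x \<in> set xs" "set xs \<subseteq> V"
    "\<And>u. {u, xs ! 0} \<in> E \<Longrightarrow> u \<in> set xs"
    "\<And>u. {u, rev xs ! 0} \<in> E \<Longrightarrow> u \<in> set xs"
proof -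
  let ?P = "\<lambda>xs. path E xs \<and> x \<in> set xs \<and> set xs \<subseteq> V"
  have "?P [x]"
    using assms by (auto simp: path_def)
  moreover have "\<forall>ys. ?P ys \<longrightarrow> length ys < Suc (card V)"
    using assms(1) by (metis path_def card_mono distinct_card le_imp_less_Suc)
  ultimately obtain xs where xs: "?P xs" and max: "\<And>ys. ?P ys \<Longrightarrow> length ys \<le> length xs"
    using ex_has_greatest_nat[of ?P "[x]" length "Suc (card V)"] by (metis less_imp_le)
  have *: "u \<in> set ys" if "?P ys" "length ys = length xs" "{u, ys ! 0} \<in> E" for u ys
  proof (rule ccontr)
    assume "u \<notin> set ys"
    moreover have "u \<in> V"
      using that assms by auto
    ultimately have "?P (u # ys)"
      using that by (auto intro: path_Cons)
    from max[OF this] show False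
      using that by simp
  qed
  have "?P (rev xs)"
    using xs path_rev by auto
  with xs * * [of "rev xs"] show ?thesis
    by (intro that[of xs]) auto
qed

text \<open>A neighbour of the first vertex lying further along would close a cycle with the initial
  segment up to it.\<close>

lemma path_end_neighbour:
  assumes p: "path E xs" and acyc: "\<nexists>ys. is_cycle E ys"
    and u: "u \<in> set xs" "{u, xs ! 0} \<in> E" "u \<noteq> xs ! 0"
  shows "Suc 0 < length xs \<and> u = xs ! Suc 0"
proof -
  obtain k where k: "k < length xs" "u = xs ! k"
    using u(1) by (auto simp: in_set_conv_nth)
  with u have "k \<noteq> 0" by (cases k) auto
  moreover have "\<not> 2 \<le> k"
  proof
    assume k2: "2 \<le> k"
    have "is_cycle E (take (Suc k) xs)"
      unfolding is_cycle_def
    proof (intro conjI allI impI)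
      show "3 \<le> length (take (Suc k) xs)" "distinct (take (Suc k) xs)"
        using k k2 p by (auto simp: path_def)
      fix i assume i: "i < length (take (Suc k) xs)"
      then show "{take (Suc k) xs ! i, take (Suc k) xs ! (Suc i mod length (take (Suc k) xs))} \<in> E"
        using k p u by (cases "i = k") (auto simp: path_def)
    qed
    with acyc show False by blast
  qed
  ultimately have "k = Suc 0" by simp
  with k show ?thesis by simp
qed

text \<open>The component of \<open>v\<close> is a maximal path through \<open>v\<close>. No edge
  leaves this path or cuts across it: at an end by maximality and acyclicity, at an inner vertex
  because the two path edges exhaust the degree.\<close>

lemma lin_imp_linear_forest:
  assumes "finite V" "simple_graph V E" "lin E"
  shows "linear_forest V E"
proof -
  have fin: "finite E" and deg: "\<And>v. degree E v \<le> 2" and acyc: "\<nexists>xs. is_cycle E xs"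
    using assms by (auto simp: lin_def)
  have E: "\<forall>e\<in>E. e \<subseteq> V" and card2: "\<And>e. e \<in> E \<Longrightarrow> card e = 2"
    using assms by (auto simp: simple_graph_def)
  have "path_graph C (induced_edges E C)" if C: "C \<in> components V E" for C
  proof -
    obtain v where v: "v \<in> V" "C = {u \<in> V. (v, u) \<in> (adj E)\<^sup>*}"
      using C by (auto simp: components_def)
    obtain xs where p: "path E xs" and xs: "v \<in> set xs" "set xs \<subseteq> V"
      and hd: "\<And>u. {u, xs ! 0} \<in> E \<Longrightarrow> u \<in> set xs"
      and last: "\<And>u. {u, rev xs ! 0} \<in> E \<Longrightarrow> u \<in> set xs"
      using maximal_path[OF assms(1) E v(1)] by metis
    let ?n = "length xs"
    have d: "distinct xs" and pe: "\<And>i. Suc i < ?n \<Longrightarrow> {xs ! i, xs ! Suc i} \<in> E"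
      using p by (auto simp: path_def)
    have closed: "\<exists>i. Suc i < ?n \<and> {a, b} = {xs ! i, xs ! Suc i}"
      if ab: "a \<in> set xs" "{a, b} \<in> E" for a b
    proof -
      have ne: "a \<noteq> b"
        using card2[OF ab(2)] by auto
      obtain i where i: "i < ?n" "a = xs ! i"
        using ab(1) by (auto simp: in_set_conv_nth)
      consider "i = 0" | "i = ?n - 1" | "i \<noteq> 0" "Suc i < ?n"
        using i by linarith
      then show ?thesis
      proof cases
        case 1
        then have "b \<in> set xs"
          using hd[of b] ab i by (simp add: insert_commute)
        then have "Suc 0 < ?n \<and> b = xs ! Suc 0"
          using path_end_neighbour[OF p acyc] ab ne i 1 by (metis insert_commute)
        then show ?thesis
          using 1 i by auto
      next
        case 2
        have a: "a = rev xs ! 0"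
          using i 2 by (cases xs rule: rev_cases) auto
        then have "b \<in> set xs"
          using last[of b] ab by (simp add: insert_commute)
        then have *: "Suc 0 < length (rev xs) \<and> b = rev xs ! Suc 0"
          using path_end_neighbour[OF path_rev[OF p] acyc] ab ne a by (metis insert_commute set_rev)
        have "Suc (?n - 2) < ?n" "b = xs ! (?n - 2)" "a = xs ! Suc (?n - 2)"
          using * i 2 by (auto simp: rev_nth numeral_2_eq_2 Suc_diff_Suc)
        then show ?thesis by (intro exI[of _ "?n - 2"]) auto
      next
        case 3
        define j where "j = i - 1"
        have j: "Suc j = i" "Suc j < ?n"
          using 3 by (auto simp: j_def)
        have e: "{xs ! j, a} \<in> E" "{a, xs ! Suc i} \<in> E"
          using pe[of j] pe[of i] i j 3 by auto
        have "xs ! j \<noteq> xs ! Suc i" "xs ! j \<noteq> a" "a \<noteq> xs ! Suc i"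
          using d i j 3 by (auto simp: nth_eq_iff_index_eq)
        then have ne': "{xs ! j, a} \<noteq> {a, xs ! Suc i}"
          by (auto simp: doubleton_eq_iff)
        have "{a, b} = {xs ! j, a} \<or> {a, b} = {a, xs ! Suc i}"
        proof (rule ccontr)
          assume "\<not> ?thesis"
          then have "card {{a, b}, {xs ! j, a}, {a, xs ! Suc i}} = 3"
            using ne' by auto
          moreover have "card {{a, b}, {xs ! j, a}, {a, xs ! Suc i}} \<le> degree E a"
            by (rule card_le_degree) (use fin e ab in auto)
          ultimately show False
            using deg[of a] by simp
        qed
        then show ?thesis
          using i j 3 by blast
      qed
    qed
    have "C = set xs"
    proof
      have "u \<in> set xs" if "(v, u) \<in> (adj E)\<^sup>*" for u
        using that
      proof induction
        case (step y z)
        then obtain i where "Suc i < ?n" "{y, z} = {xs ! i, xs ! Suc i}"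
          using closed[of y z] by (auto simp: adj_def)
        then show ?case
          by (auto simp: doubleton_eq_iff)
      qed (rule xs)
      then show "C \<subseteq> set xs"
        using v by auto
    next
      have reach: "(xs ! 0, xs ! i) \<in> (adj E)\<^sup>*" if "i < ?n" for i
        using that
      proof (induction i)
        case (Suc i)
        then have "(xs ! i, xs ! Suc i) \<in> adj E"
          using pe by (auto simp: adj_def)
        with Suc show ?case by (auto intro: rtrancl.rtrancl_into_rtrancl)
      qed simp
      have "sym (adj E)"
        by (auto simp: sym_def adj_def insert_commute)
      then have "sym ((adj E)\<^sup>*)"
        by (rule sym_rtrancl)
      then have "(v, u) \<in> (adj E)\<^sup>*" if "u \<in> set xs" for u
        using reach xs(1) that by (metis in_set_conv_nth rtrancl_trans symD)
      then show "set xs \<subseteq> C"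
        using xs v by auto
    qed
    moreover have "induced_edges E (set xs) = {{xs ! i, xs ! Suc i} | i. Suc i < ?n}"
    proof
      show "induced_edges E (set xs) \<subseteq> {{xs ! i, xs ! Suc i} | i. Suc i < ?n}"
      proof
        fix e assume e: "e \<in> induced_edges E (set xs)"
        then obtain a b where "e = {a, b}"
          using card2[of e] by (auto simp: induced_edges_def card_2_iff)
        then show "e \<in> {{xs ! i, xs ! Suc i} | i. Suc i < ?n}"
          using closed[of a b] e by (auto simp: induced_edges_def)
      qed
    qed (use pe in \<open>auto simp: induced_edges_def\<close>)
    ultimately show ?thesis
      unfolding path_graph_def using p by (intro exI[of _ xs] conjI) (auto simp: path_def)
  qed
  then show ?thesis
    using assms acyc by (auto simp: linear_forest_def forest_def)
qed

section \<open>Decompositions of width at most 2\<close>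

text \<open>An end of a maximal path is a leaf: maximality puts its neighbours on the path, and
  acyclicity leaves only the next vertex.\<close>

lemma forest_leaf:
  assumes "finite T" "simple_graph T F" "\<nexists>xs. is_cycle F xs" "F \<noteq> {}"
  obtains l p where "l \<noteq> p" "{l, p} \<in> F" "\<And>e. e \<in> F \<Longrightarrow> l \<in> e \<Longrightarrow> e = {l, p}"
proof -
  have F: "\<forall>e\<in>F. e \<subseteq> T" and card2: "\<And>e. e \<in> F \<Longrightarrow> card e = 2"
    using assms by (auto simp: simple_graph_def)
  obtain a b where ab: "{a, b} \<in> F" "a \<noteq> b"
    using assms(4) card2 by (metis card_2_iff equals0I)
  then have "a \<in> T" using F by auto
  then obtain xs where p: "path F xs" and xs: "a \<in> set xs"
    and hd: "\<And>u. {u, xs ! 0} \<in> F \<Longrightarrow> u \<in> set xs"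
    using maximal_path[OF assms(1) F] by metis
  have nbr: "Suc 0 < length xs \<and> u = xs ! Suc 0" if "{xs ! 0, u} \<in> F" for u
  proof -
    have "u \<noteq> xs ! 0"
      using card2[OF that] by auto
    moreover have "{u, xs ! 0} \<in> F"
      using that by (simp add: insert_commute)
    ultimately show ?thesis
      using path_end_neighbour[OF p assms(3)] hd by blast
  qed
  have len: "Suc 0 < length xs"
  proof (rule ccontr)
    assume "\<not> ?thesis"
    then have "xs ! 0 = a"
      using xs by (cases xs) auto
    then show False
      using nbr[of b] ab \<open>\<not> Suc 0 < length xs\<close> by auto
  qed
  show ?thesis
  proof (rule that)
    show "{xs ! 0, xs ! Suc 0} \<in> F"
      using p len by (auto simp: path_def)
    then show "xs ! 0 \<noteq> xs ! Suc 0"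
      using card2 by fastforce
    show "e = {xs ! 0, xs ! Suc 0}" if "e \<in> F" "xs ! 0 \<in> e" for e
      using that card2[of e] nbr by (auto simp: card_2_iff insert_commute)
  qed
qed

text \<open>Unlike \<open>connected_graph\<close>, this holds vacuously when \<open>v\<close> occurs
  in no bag, so it can be required of every \<open>v\<close>.\<close>

definition bag_connected :: "'t set \<Rightarrow> 't set set \<Rightarrow> ('t \<Rightarrow> 'a set) \<Rightarrow> 'a \<Rightarrow> bool" where
  "bag_connected T F bag v \<longleftrightarrow> (\<forall>s\<in>T. \<forall>t\<in>T. v \<in> bag s \<longrightarrow> v \<in> bag t \<longrightarrow>
     (s, t) \<in> (adj (induced_edges F {t \<in> T. v \<in> bag t}))\<^sup>*)"

lemma bag_connectedD:
  assumes "bag_connected T F bag v" "s \<in> T" "t \<in> T" "v \<in> bag s" "v \<in> bag t"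
  shows "(s, t) \<in> (adj (induced_edges F {t \<in> T. v \<in> bag t}))\<^sup>*"
  using assms unfolding bag_connected_def by blast

lemma simplicial_vertex:
  assumes "finite T" "simple_graph T F" "\<nexists>xs. is_cycle F xs"
    and "\<forall>v. bag_connected T F bag v" "\<exists>t\<in>T. bag t \<noteq> {}"
  shows "\<exists>t\<in>T. \<exists>x\<in>bag t. \<forall>s\<in>T. x \<in> bag s \<longrightarrow> bag s \<subseteq> bag t"
  using assms
proof (induction "card T" arbitrary: T F rule: less_induct)
  case less
  show ?case
  proof (cases "F = {}")
    case True
    then have "adj (induced_edges F W) = {}" for W
      by (auto simp: induced_edges_def adj_def)
    then have "s = t" if "s \<in> T" "t \<in> T" "v \<in> bag s" "v \<in> bag t" for s t v
      using bag_connectedD[OF spec[OF less.prems(4)] that] by simp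
    then show ?thesis
      using less.prems(5) by blast
  next
    case False
    then obtain l p where lp: "l \<noteq> p" "{l, p} \<in> F" and leaf: "\<And>e. e \<in> F \<Longrightarrow> l \<in> e \<Longrightarrow> e = {l, p}"
      using forest_leaf[OF less.prems(1-3)] by metis
    have T: "l \<in> T" "p \<in> T"
      using lp less.prems(2) by (auto simp: simple_graph_def)
    show ?thesis
    proof (cases "bag l \<subseteq> bag p")
      case False
      then obtain x where x: "x \<in> bag l" "x \<notin> bag p" by auto
      have "s = l" if "s \<in> T" "x \<in> bag s" for s
      proof -
        have "(l, s) \<in> (adj (induced_edges F {t \<in> T. x \<in> bag t}))\<^sup>*"
          using bag_connectedD[OF spec[OF less.prems(4)]] that T x by blast
        then show ?thesis
        proof (cases rule: converse_rtranclE)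
          case (step y)
          then have e: "{l, y} \<in> F" "x \<in> bag y"
            by (auto simp: adj_def induced_edges_def)
          then have "{l, y} = {l, p}"
            using leaf by auto
          then show ?thesis
            using e x by (auto simp: doubleton_eq_iff)
        qed simp
      qed
      then show ?thesis
        using T x by auto
    next
      case True
      let ?T = "T - {l}" and ?F = "F - {{l, p}}"
      have "bag_connected ?T ?F bag v" for v
        unfolding bag_connected_def
      proof (intro ballI impI)
        fix s t assume st: "s \<in> ?T" "t \<in> ?T" "v \<in> bag s" "v \<in> bag t"
        \<comment> \<open>Retracting the leaf onto its neighbour turns walks through
          \<open>l\<close> into walks that avoid it.\<close>
        let ?g = "\<lambda>u. if u = l then p else u"
        let ?A = "adj (induced_edges F {t \<in> T. v \<in> bag t})"
          and ?A' = "adj (induced_edges ?F {t \<in> ?T. v \<in> bag t})"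
        have step: "(?g a, ?g b) \<in> ?A'\<^sup>*" if "(a, b) \<in> ?A" for a b
        proof (cases "a = l \<or> b = l")
          case True
          have "{a, b} \<in> F"
            using that by (auto simp: adj_def induced_edges_def)
          then have "{a, b} = {l, p}"
            using True leaf[of "{a, b}"] by auto
          then show ?thesis
            by (auto simp: doubleton_eq_iff)
        next
          case False
          then have "(a, b) \<in> ?A'"
            using that by (auto simp: adj_def induced_edges_def doubleton_eq_iff)
          then show ?thesis
            using False by auto
        qed
        have "(s, t) \<in> ?A\<^sup>*"
          using bag_connectedD[OF spec[OF less.prems(4)]] st by blast
        then have "(?g s, ?g t) \<in> ?A'\<^sup>*"
        proof induction
          case (step y z)
          then show ?case
            using \<open>\<And>a b. (a, b) \<in> ?A \<Longrightarrow> (?g a, ?g b) \<in> ?A'\<^sup>*\<close> by (blast intro: rtrancl_trans)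
        qed simp
        then show "(s, t) \<in> ?A'\<^sup>*"
          using st by auto
      qed
      moreover have "card ?T < card T"
        using T less.prems(1) by (meson card_Diff1_less)
      moreover have "simple_graph ?T ?F"
        using less.prems(2) leaf by (fastforce simp: simple_graph_def)
      moreover have "\<nexists>xs. is_cycle ?F xs"
        using less.prems(3) is_cycle_mono by blast
      moreover have "\<exists>t\<in>?T. bag t \<noteq> {}"
        using less.prems(5) True T lp by (cases "bag p = {}") auto
      ultimately obtain t x where "t \<in> ?T" "x \<in> bag t" and
        tx: "\<And>s. s \<in> ?T \<Longrightarrow> x \<in> bag s \<Longrightarrow> bag s \<subseteq> bag t"
        using less.hyps[of ?T ?F] less.prems(1) by (metis finite_Diff)
      \<comment> \<open>Here \<open>x\<close> also lies in \<open>bag p\<close>, so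
        \<open>bag l \<subseteq> bag p \<subseteq> bag t\<close>.\<close>
      moreover have "bag l \<subseteq> bag t" if "x \<in> bag l"
        using that tx[of p] True T lp by auto
      ultimately show ?thesis
        by (metis DiffD1 Diff_iff empty_iff insert_iff)
    qed
  qed
qed

text \<open>Bags may contain vertices that meet no edge, so one decomposition serves every subset of
  the edges.\<close>

definition width_le_2 :: "'a set set \<Rightarrow> bool" where
  "width_le_2 E \<longleftrightarrow> (\<exists>(T :: nat set) F bag. finite T \<and> simple_graph T F \<and> (\<nexists>xs. is_cycle F xs) \<and>
     (\<forall>e\<in>E. \<exists>t\<in>T. e \<subseteq> bag t) \<and> (\<forall>v. bag_connected T F bag v) \<and>
     (\<forall>t\<in>T. finite (bag t) \<and> card (bag t) \<le> 3))"

lemma width_le_2_mono: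
  assumes "width_le_2 E" "E' \<subseteq> E"
  shows "width_le_2 E'"
proof -
  obtain T :: "nat set" and F bag where "finite T \<and> simple_graph T F \<and> (\<nexists>xs. is_cycle F xs) \<and>
     (\<forall>e\<in>E. \<exists>t\<in>T. e \<subseteq> bag t) \<and> (\<forall>v. bag_connected T F bag v) \<and>
     (\<forall>t\<in>T. finite (bag t) \<and> card (bag t) \<le> 3)"
    using assms(1) unfolding width_le_2_def by (elim exE)
  then show ?thesis
    unfolding width_le_2_def using assms(2)
    by (intro exI[of _ T] exI[of _ F] exI[of _ bag]) blast
qed

lemma partial_2_tree_imp_width_le_2:
  assumes "finite V" "partial_2_tree V E"
  shows "width_le_2 E"
proof -
  obtain T :: "nat set" and F bag
    where td: "tree_decomposition V E T F bag" and w: "decomposition_width T bag \<le> 2"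
    using assms(2) unfolding partial_2_tree_def by blast
  have T: "finite T" "simple_graph T F" "\<nexists>xs. is_cycle F xs" "(\<Union>t\<in>T. bag t) = V"
    "\<forall>e\<in>E. \<exists>t\<in>T. e \<subseteq> bag t"
    using td by (auto simp: tree_decomposition_def tree_def forest_def)
  have conn: "connected_graph {t \<in> T. v \<in> bag t} (induced_edges F {t \<in> T. v \<in> bag t})" if "v \<in> V" for v
    using td that by (auto simp: tree_decomposition_def)
  have "bag_connected T F bag v" for v
    using conn[of v] T(4) by (auto simp: bag_connected_def connected_graph_def)
  moreover have "finite (bag t) \<and> card (bag t) \<le> 3" if "t \<in> T" for t
  proof
    show "finite (bag t)"
      using T(4) that assms(1) by (meson UN_upper finite_subset)
    have "card (bag t) \<le> Max ((\<lambda>t. card (bag t)) ` T)"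
      using T(1) that by auto
    then show "card (bag t) \<le> 3"
      using w unfolding decomposition_width_def by linarith
  qed
  ultimately show ?thesis
    unfolding width_le_2_def using T by blast
qed

section \<open>Unavoidable configurations in graphs of width at most 2\<close>

lemma degree_eq_card_neighbours:
  assumes "\<forall>e\<in>E. card e = 2"
  shows "degree E x = card {w. {x, w} \<in> E}"
proof -
  have "{e \<in> E. x \<in> e} = (\<lambda>w. {x, w}) ` {w. {x, w} \<in> E}"
  proof
    show "{e \<in> E. x \<in> e} \<subseteq> (\<lambda>w. {x, w}) ` {w. {x, w} \<in> E}"
    proof
      fix e assume "e \<in> {e \<in> E. x \<in> e}"
      moreover from this obtain p q where "e = {p, q}"
        using assms by (auto simp: card_2_iff)
      ultimately obtain w where "e = {x, w}" "e \<in> E"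
        by (auto simp: insert_commute)
      then show "e \<in> (\<lambda>w. {x, w}) ` {w. {x, w} \<in> E}" by auto
    qed
  qed auto
  moreover have "inj_on (\<lambda>w. {x, w}) {w. {x, w} \<in> E}"
    by (auto simp: inj_on_def doubleton_eq_iff)
  ultimately show ?thesis
    by (simp add: degree_def card_image)
qed

text \<open>
  Contracting every vertex of degree 2 into one of its neighbours yields a graph of width at most 2
  on the remaining vertices, and a simplicial vertex of its decomposition is the desired \<open>x\<close>.
\<close>

lemma width_le_2_reducible_vertex:
  assumes fin: "finite E" and card2: "\<forall>e\<in>E. card e = 2" and w: "width_le_2 E" and ne: "E \<noteq> {}"
    and deg1: "\<forall>v. degree E v \<noteq> 1"
    and deg2: "\<forall>u v. {u, v} \<in> E \<longrightarrow> \<not> (degree E u = 2 \<and> degree E v = 2)"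
  obtains x y z where "3 \<le> degree E x"
    "\<And>u. {x, u} \<in> E \<Longrightarrow> u = y \<or> u = z \<or> degree E u = 2 \<and> (\<exists>q\<in>{y, z}. q \<noteq> x \<and> {u, q} \<in> E)"
proof -
  obtain T :: "nat set" and F bag where T: "finite T" "simple_graph T F" "\<nexists>xs. is_cycle F xs"
    and cover: "\<And>e. e \<in> E \<Longrightarrow> \<exists>t\<in>T. e \<subseteq> bag t" and conn: "\<And>v. bag_connected T F bag v"
    and bag: "\<And>t. t \<in> T \<Longrightarrow> finite (bag t) \<and> card (bag t) \<le> 3"
    using w unfolding width_le_2_def by metis
  have ge2: "2 \<le> degree E u" if "{u, v} \<in> E" for u v
  proof -
    have "degree E u \<noteq> 0"
      using that fin by (auto simp: degree_eq_0_iff)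
    then show ?thesis
      using deg1 by (metis One_nat_def Suc_1 Suc_leI le_neq_implies_less not_gr_zero)
  qed
  have ge3: "3 \<le> degree E v" if "{u, v} \<in> E" "degree E u = 2" for u v
  proof -
    have "2 \<le> degree E v" "degree E v \<noteq> 2"
      using that deg2 ge2[of v u] by (auto simp: insert_commute)
    then show ?thesis by simp
  qed
  \<comment> \<open>Vertices of degree 2 are pairwise non-adjacent, so their chosen neighbours have
    degree at least 3 and are fixed by \<open>f\<close>: one application contracts
    completely.\<close>
  define f where "f v = (if degree E v = 2 then SOME u. {v, u} \<in> E else v)" for v
  have f: "{v, f v} \<in> E" if "degree E v = 2" for v
  proof -
    have "{u. {v, u} \<in> E} \<noteq> {}"
      using that degree_eq_card_neighbours[OF card2, of v] by (metis card.empty zero_neq_numeral)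
    then show ?thesis
      using that by (auto simp: f_def intro: someI)
  qed
  have f_id: "f v = v" if "3 \<le> degree E v" for v
    using that by (auto simp: f_def)
  have f3: "3 \<le> degree E (f v)" if "2 \<le> degree E v" for v
  proof (cases "degree E v = 2")
    case True
    then show ?thesis using ge3[OF f[OF True]] by simp
  next
    case False
    then show ?thesis using that f_id[of v] by simp
  qed
  \<comment> \<open>Vertices of degree below 2 are dropped, so every member of a new bag has degree
    at least 3.\<close>
  define bag' where "bag' t = f ` {v \<in> bag t. 2 \<le> degree E v}" for t
  have bag'I: "f v \<in> bag' t" if "v \<in> bag t" "2 \<le> degree E v" for v t
    using that by (auto simp: bag'_def)
  have "bag_connected T F bag' u" for u
    unfolding bag_connected_def
  proof (intro ballI impI)
    let ?A = "adj (induced_edges F {t \<in> T. u \<in> bag' t})"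
    have sub: "(adj (induced_edges F {t \<in> T. v \<in> bag t}))\<^sup>* \<subseteq> ?A\<^sup>*"
      if "f v = u" "2 \<le> degree E v" for v
      using that by (intro rtrancl_mono) (auto simp: adj_def induced_edges_def dest!: bag'I)
    have sym: "sym (?A\<^sup>*)"
      by (rule sym_rtrancl) (auto simp: sym_def adj_def insert_commute)
    \<comment> \<open>A node whose new bag holds \<open>u\<close> is linked to one whose original
      bag holds \<open>u\<close>: among the bags of a contracted \<open>v\<close> there is one that
      covers the edge \<open>{v, u}\<close>.\<close>
    have root: "\<exists>s0\<in>T. u \<in> bag s0 \<and> (s, s0) \<in> ?A\<^sup>*" if "s \<in> T" "u \<in> bag' s" for s
    proof -
      obtain v where v: "v \<in> bag s" "2 \<le> degree E v" "u = f v"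
        using \<open>u \<in> bag' s\<close> by (auto simp: bag'_def)
      show ?thesis
      proof (cases "degree E v = 2")
        case False
        then show ?thesis
          using v f_id[of v] \<open>s \<in> T\<close> by (intro bexI[of _ s]) auto
      next
        case True
        then obtain s0 where s0: "s0 \<in> T" "{v, u} \<subseteq> bag s0"
          using cover[OF f[OF True]] v by auto
        then have "(s, s0) \<in> (adj (induced_edges F {t \<in> T. v \<in> bag t}))\<^sup>*"
          using conn[of v] v \<open>s \<in> T\<close> by (auto simp: bag_connected_def)
        then show ?thesis
          using sub[of v] v s0 by auto
      qed
    qed
    fix s t assume st: "s \<in> T" "t \<in> T" "u \<in> bag' s" "u \<in> bag' t"
    have u3: "3 \<le> degree E u"
      using st(3) f3 by (auto simp: bag'_def)
    obtain s0 t0 where s0: "s0 \<in> T" "u \<in> bag s0" "(s, s0) \<in> ?A\<^sup>*"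
      and t0: "t0 \<in> T" "u \<in> bag t0" "(t, t0) \<in> ?A\<^sup>*"
      using root st by meson
    have "(s0, t0) \<in> ?A\<^sup>*"
      using conn[of u] s0 t0 sub[of u] f_id[OF u3] u3 by (auto simp: bag_connected_def)
    moreover have "(t0, t) \<in> ?A\<^sup>*"
      using t0 sym by (auto dest: symD)
    ultimately show "(s, t) \<in> ?A\<^sup>*"
      using s0 by (meson rtrancl_trans)
  qed
  moreover have "\<exists>t\<in>T. bag' t \<noteq> {}"
  proof -
    obtain u v where e: "{u, v} \<in> E"
      using ne card2 by (metis card_2_iff equals0I)
    then obtain t where "t \<in> T" "{u, v} \<subseteq> bag t"
      using cover by blast
    then show ?thesis
      using bag'I[of u t] ge2[OF e] by auto
  qed
  ultimately obtain t x where t: "t \<in> T" "x \<in> bag' t"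
    and simpl: "\<And>s. s \<in> T \<Longrightarrow> x \<in> bag' s \<Longrightarrow> bag' s \<subseteq> bag' t"
    using simplicial_vertex[OF T, of bag'] by blast
  have x3: "3 \<le> degree E x"
    using t(2) f3 by (auto simp: bag'_def)
  have fin': "finite (bag' t)"
    using bag[OF t(1)] by (auto simp: bag'_def)
  have "card (bag' t) \<le> card {v \<in> bag t. 2 \<le> degree E v}"
    unfolding bag'_def using bag[OF t(1)] by (intro card_image_le) auto
  also have "\<dots> \<le> card (bag t)"
    using bag[OF t(1)] by (intro card_mono) auto
  finally have "card (bag' t) \<le> 3"
    using bag[OF t(1)] by simp
  then have c: "card (bag' t - {x}) \<le> 2"
    using t(2) fin' by (simp add: card_Diff_singleton)
  have "\<exists>y z. D \<subseteq> {y, z}" if "finite D" "card D \<le> 2" for D :: "'a set"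
  proof -
    have "card D = 0 \<or> card D = 1 \<or> card D = 2"
      using that by linarith
    then show ?thesis
      using that by (auto simp: card_1_singleton_iff card_2_iff)
  qed
  \<comment> \<open>A bag of size at most 3 leaves two candidates besides \<open>x\<close>. The
    inclusion does not prevent \<open>y\<close> or \<open>z\<close> from being \<open>x\<close>,
    which is why the conclusion says \<open>q \<noteq> x\<close>.\<close>
  from this[OF _ c] obtain y z where yz: "bag' t - {x} \<subseteq> {y, z}"
    using fin' by auto
  \<comment> \<open>An edge contracted to \<open>{x, q}\<close> lies in some bag; its contraction
    contains \<open>x\<close> and is therefore contained in \<open>bag' t\<close>.\<close>
  have near: "q \<in> {y, z}" if e: "{u, v} \<in> E" and q: "{f u, f v} = {x, q}" "q \<noteq> x" for u v q
  proof -
    obtain s where s: "s \<in> T" "{u, v} \<subseteq> bag s"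
      using cover[OF e] by auto
    then have "{f u, f v} \<subseteq> bag' s"
      using bag'I ge2[OF e] ge2[of v u] e by (auto simp: insert_commute)
    then have "x \<in> bag' s" "q \<in> bag' s"
      using q by auto
    then show ?thesis
      using simpl[OF s(1)] q(2) yz by auto
  qed
  show ?thesis
  proof (rule that[OF x3, of y z])
    fix u assume e: "{x, u} \<in> E"
    then have ux: "u \<noteq> x"
      using card2 by auto
    show "u = y \<or> u = z \<or> degree E u = 2 \<and> (\<exists>q\<in>{y, z}. q \<noteq> x \<and> {u, q} \<in> E)"
    proof (cases "degree E u = 2")
      case False
      then have "3 \<le> degree E u"
        using ge2[of u x] e by (simp add: insert_commute)
      then show ?thesis
        using near[OF e, of u] f_id x3 ux by auto
    next
      case True
      then have "card {v. {u, v} \<in> E} = 2"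
        using degree_eq_card_neighbours[OF card2, of u] by simp
      then obtain a c where ac: "{v. {u, v} \<in> E} = {a, c}" "a \<noteq> c"
        by (auto simp: card_2_iff)
      moreover have "x \<in> {v. {u, v} \<in> E}"
        using e by (simp add: insert_commute)
      ultimately obtain q where q: "q \<noteq> x" "{v. {u, v} \<in> E} = {x, q}"
        by (metis insertE insert_commute singletonD)
      then have uq: "{u, q} \<in> E" by auto
      have fq: "f q = q" "f x = x"
        using ge3[OF uq True] f_id x3 by auto
      have "f u \<in> {x, q}"
        using f[OF True] q by auto
      \<comment> \<open>If \<open>u\<close> is contracted into \<open>x\<close>, its edge to
        \<open>q\<close> becomes an edge between \<open>x\<close> and \<open>q\<close>; if it is
        contracted into \<open>q\<close>, its edge to \<open>x\<close> does.\<close>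
      then have "{f u, f q} = {x, q} \<or> {f x, f u} = {x, q}"
        using fq by auto
      then have "q \<in> {y, z}"
        using near[OF uq _ q(1)] near[OF e _ q(1)] by auto
      then show ?thesis
        using True q uq by auto
    qed
  qed
qed

text \<open>A count at \<open>x\<close>. Each of \<open>y\<close> and \<open>z\<close> accounts for
  itself and for the vertices of degree 2 joining it to \<open>x\<close>. Two such vertices form a
  square, so each accounts for at most two neighbours, and for two only in a triangle. Degree at
  least 3 at \<open>x\<close> yields a triangle; if degree 3 is barred there, \<open>x\<close> has
  degree 4, and both \<open>y\<close> and \<open>z\<close> must lie in triangles.\<close>

lemma width_le_2_configuration:
  assumes fin: "finite E" and card2: "\<forall>e\<in>E. card e = 2" and w: "width_le_2 E" and ne: "E \<noteq> {}"
    and deg1: "\<forall>v. degree E v \<noteq> 1"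
    and deg2: "\<forall>u v. {u, v} \<in> E \<longrightarrow> \<not> (degree E u = 2 \<and> degree E v = 2)"
    and deg4: "\<forall>v. degree E v \<le> 4"
  obtains
    (square) x y a c where "distinct [x, y, a, c]" "{x, a} \<in> E" "{x, c} \<in> E" "{y, a} \<in> E" "{y, c} \<in> E"
      "degree E a = 2" "degree E c = 2" "3 \<le> degree E x" "3 \<le> degree E y"
  | (triangle) x y v where "distinct [x, y, v]" "{x, y} \<in> E" "{x, v} \<in> E" "{y, v} \<in> E"
      "degree E v = 2" "degree E x = 3" "3 \<le> degree E y"
  | (bowtie) x y z v w where "distinct [x, y, z, v, w]"
      "{x, y} \<in> E" "{x, v} \<in> E" "{y, v} \<in> E" "{x, z} \<in> E" "{x, w} \<in> E" "{z, w} \<in> E"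
      "degree E v = 2" "degree E w = 2" "degree E x = 4" "degree E y = 4" "degree E z = 4"
proof (rule ccontr)
  assume none: "\<not> thesis"
  obtain x y z where x3: "3 \<le> degree E x" and
    nbr: "\<And>u. {x, u} \<in> E \<Longrightarrow> u = y \<or> u = z \<or> degree E u = 2 \<and> (\<exists>q\<in>{y, z}. q \<noteq> x \<and> {u, q} \<in> E)"
    by (rule width_le_2_reducible_vertex[OF fin card2 w ne deg1 deg2]) blast
  have loop: "{u, u} \<notin> E" for u
    using card2 by auto
  have ge3: "3 \<le> degree E v" if "{u, v} \<in> E" "degree E u = 2" for u v
  proof -
    have "degree E v \<noteq> 0"
      using that fin by (auto simp: degree_eq_0_iff)
    moreover have "degree E v \<noteq> 1" "degree E v \<noteq> 2"
      using that deg1 deg2 by auto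
    ultimately show ?thesis by linarith
  qed
  define N where "N q = {u. {x, u} \<in> E \<and> (u = q \<or> degree E u = 2 \<and> q \<noteq> x \<and> {u, q} \<in> E)}" for q
  let ?tri = "\<lambda>q v. {x, q} \<in> E \<and> {x, v} \<in> E \<and> {q, v} \<in> E \<and> degree E v = 2 \<and> 3 \<le> degree E q \<and> distinct [x, q, v]"
  have N: "finite (N q) \<and> (card (N q) \<le> 1 \<or> card (N q) \<le> 2 \<and> (\<exists>v. ?tri q v))" for q
  proof -
    define D where "D = {u. {x, u} \<in> E \<and> degree E u = 2 \<and> q \<noteq> x \<and> {u, q} \<in> E}"
    have "a = c" if ac: "a \<in> D" "c \<in> D" for a c
    proof (rule ccontr)
      assume "a \<noteq> c"
      have d: "distinct [x, q, a, c]"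
        using ac \<open>a \<noteq> c\<close> loop by (auto simp: D_def)
      have e: "{x, a} \<in> E" "{x, c} \<in> E" "{q, a} \<in> E" "{q, c} \<in> E" "degree E a = 2" "degree E c = 2"
        using ac by (auto simp: D_def insert_commute)
      have "3 \<le> degree E q"
        using e ge3[of a q] by (simp add: insert_commute)
      then show False
        using none square[OF d e x3] by blast
    qed
    then have "D = {} \<or> (\<exists>v. D = {v})"
      by blast
    moreover have "N q \<subseteq> (if {x, q} \<in> E then insert q D else D)"
      by (auto simp: N_def D_def)
    moreover have "?tri q v" if "{x, q} \<in> E" "v \<in> D" for v
      using that loop ge3[of v q] by (auto simp: D_def insert_commute)
    ultimately show ?thesis
    proof (elim disjE exE, goal_cases)
      case 1
      then have s: "N q \<subseteq> {q}" by (auto split: if_splits)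
      then have "card (N q) \<le> card {q}" by (intro card_mono) auto
      then show ?case
        using s by (auto intro: finite_subset)
    next
      case (2 v)
      show ?case
      proof (cases "{x, q} \<in> E")
        case True
        then have s: "N q \<subseteq> {q, v}" using 2 by auto
        then have "card (N q) \<le> card {q, v}" by (intro card_mono) auto
        also have "\<dots> \<le> 2" by (simp add: card_insert_if)
        finally show ?thesis
          using 2 True s by (auto intro: finite_subset)
      next
        case False
        then have s: "N q \<subseteq> {v}" using 2 by auto
        then have "card (N q) \<le> card {v}" by (intro card_mono) auto
        then show ?thesis
          using s by (auto intro: finite_subset)
      qed
    qed
  qed
  have sub: "{u. {x, u} \<in> E} \<subseteq> N y \<union> N z"
    using nbr by (fastforce simp: N_def)
  have "degree E x \<le> card (N y \<union> N z)"
    unfolding degree_eq_card_neighbours[OF card2] using sub N by (intro card_mono) auto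
  also have "\<dots> \<le> card (N y) + card (N z)"
    by (rule card_Un_le)
  finally have cx: "degree E x \<le> card (N y) + card (N z)" .
  have x4: "degree E x = 4" if "?tri q v" for q v
    using triangle[of x q v] none that x3 deg4[rule_format, of x] by fastforce
  have q4: "degree E q = 4" if "?tri q v" for q v
    using triangle[of q x v] none that x3 deg4[rule_format, of q]
    by (fastforce simp: insert_commute)
  have le2: "card (N q) \<le> 2" for q
    using N[of q] by linarith
  have le1: "card (N q) \<le> 1" if "\<nexists>v. ?tri q v" for q
    using N[of q] that by blast
  have "\<exists>q v. ?tri q v"
  proof (rule ccontr)
    assume "\<not> ?thesis"
    then have "card (N y) \<le> 1" "card (N z) \<le> 1"
      by (intro le1; blast)+
    then show False
      using cx x3 by linarith
  qed
  then have x_4: "degree E x = 4"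
    using x4 by blast
  have "\<exists>v. ?tri y v"
  proof (rule ccontr)
    assume "\<not> ?thesis"
    from le1[OF this] show False
      using le2[of z] cx x_4 by linarith
  qed
  then obtain v where v: "?tri y v" by blast
  have "\<exists>w. ?tri z w"
  proof (rule ccontr)
    assume "\<not> ?thesis"
    from le1[OF this] show False
      using le2[of y] cx x_4 by linarith
  qed
  then obtain w where w': "?tri z w" by blast
  \<comment> \<open>Otherwise a single set of at most two vertices would account for all four
    neighbours of \<open>x\<close>.\<close>
  have yz: "y \<noteq> z"
  proof
    assume "y = z"
    then have "N y \<union> N z = N y" by simp
    then show False
      using \<open>degree E x \<le> card (N y \<union> N z)\<close> x_4 N[of y] by auto
  qed
  have "v \<noteq> w"
  proof
    assume "v = w"
    then have "{{x, v}, {y, v}, {z, v}} \<subseteq> E" using v w' by auto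
    then have "card {{x, v}, {y, v}, {z, v}} \<le> degree E v"
      using fin by (intro card_le_degree) auto
    moreover have "card {{x, v}, {y, v}, {z, v}} = 3"
      using v w' yz by (auto simp: doubleton_eq_iff)
    ultimately show False using v by simp
  qed
  moreover have "y \<noteq> w" "z \<noteq> v"
    using v w' by auto
  ultimately have "distinct [x, y, z, v, w]"
    using v w' yz by auto
  then show False
    using none bowtie[of x y z v w] v w' x_4 q4 by blast
qed

section \<open>Pairings\<close>

definition matching :: "'a set set \<Rightarrow> 'a set \<Rightarrow> bool" where
  "matching M A \<longleftrightarrow> pairwise disjnt M \<and> (\<forall>s\<in>M. s \<subseteq> A \<and> card s = 2)"

text \<open>For \<open>Q\<close> the monochromatic vertices, this is the condition that at most one
  vertex of each pair is monochromatic.\<close>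

definition avoids :: "'a set set \<Rightarrow> 'a set \<Rightarrow> bool" where
  "avoids M Q \<longleftrightarrow> (\<forall>s\<in>M. \<not> s \<subseteq> Q)"

lemma matching_unique:
  assumes "matching M A" "s \<in> M" "t \<in> M" "v \<in> s" "v \<in> t"
  shows "s = t"
  using assms by (auto simp: matching_def pairwise_def disjnt_def)

lemma matching_mono: "matching M A \<Longrightarrow> A \<subseteq> A' \<Longrightarrow> matching M A'"
  by (auto simp: matching_def)

lemma matching_not_loop: "matching M A \<Longrightarrow> {u, u} \<notin> M"
  by (auto simp: matching_def)

lemma avoids_mono: "avoids M Q \<Longrightarrow> Q' \<subseteq> Q \<Longrightarrow> avoids M Q'"
  by (auto simp: avoids_def)

lemma matching_delete: "matching M A \<Longrightarrow> matching {s \<in> M. s \<inter> X = {}} (A - X)"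
  by (auto simp: matching_def pairwise_def)

lemma avoids_delete: "avoids {s \<in> M. s \<inter> X = {}} Q \<Longrightarrow> avoids M (Q - X)"
  by (auto simp: avoids_def)

lemma matching_insert:
  assumes "matching M A" "x \<noteq> y" "x \<notin> A" "y \<notin> A"
  shows "matching (insert {x, y} M) (A \<union> {x, y})"
  using assms unfolding matching_def by (auto simp: pairwise_insert disjnt_def)

lemma matching_partner:
  assumes "matching M A" "s \<in> M" "v \<in> s"
  obtains p where "s = {v, p}" "p \<noteq> v"
proof -
  have "card s = 2" using assms by (auto simp: matching_def)
  then show ?thesis using assms(3) that by (auto simp: card_2_iff)
qed

text \<open>For deletions after which at most one of \<open>u\<close>, \<open>v\<close>, freely
  chosen, becomes monochromatic. If both have partners outside, pairing these partners with each
  other keeps one of them out of \<open>Q\<close>, and the vertex it belonged to can be the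
  monochromatic one.\<close>

lemma matching_delete2:
  assumes M: "matching M A" and "u \<noteq> v"
  obtains M' where "matching M' (A - {u, v})"
    "\<And>Q. avoids M' Q \<Longrightarrow> \<exists>w\<in>{u, v}. avoids M (insert w (Q - {u, v}))"
proof -
  let ?D = "{s \<in> M. s \<inter> {u, v} = {}}"
  have D: "matching ?D (A - {u, v})"
    by (rule matching_delete[OF M])
  have avoid: "avoids M (insert w (Q - {u, v}))"
    if "avoids ?D Q" "w \<in> {u, v}" "\<And>p. {w, p} \<in> M \<Longrightarrow> p \<in> Q - {u, v} \<Longrightarrow> False" for Q w
    unfolding avoids_def
  proof (intro ballI notI)
    fix s assume s: "s \<in> M" "s \<subseteq> insert w (Q - {u, v})"
    show False
    proof (cases "w \<in> s")
      case True
      then obtain p where "s = {w, p}" "p \<noteq> w"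
        using matching_partner[OF M s(1)] by metis
      then show False using that(3)[of p] s by auto
    next
      case False
      then have "s \<in> ?D" "s \<subseteq> Q" using s by auto
      then show False using that(1) by (auto simp: avoids_def)
    qed
  qed
  show ?thesis
  proof (cases "\<exists>a c. {u, a} \<in> M \<and> {v, c} \<in> M \<and> a \<noteq> v")
    case False
    show ?thesis
    proof (rule that[OF D])
      fix Q assume Q: "avoids ?D Q"
      show "\<exists>w\<in>{u, v}. avoids M (insert w (Q - {u, v}))"
      \<comment> \<open>Either \<open>u\<close> has a partner other than \<open>v\<close>, and then
        \<open>v\<close> has no partner, or the only possible partner of \<open>u\<close> is
        \<open>v\<close>. The vertex without an outside partner is chosen.\<close>
      proof (cases "\<exists>a. {u, a} \<in> M \<and> a \<noteq> v")
        case True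
        then have "avoids M (insert v (Q - {u, v}))"
          using False by (intro avoid[OF Q]) auto
        then show ?thesis by blast
      next
        case False
        then have "avoids M (insert u (Q - {u, v}))"
          by (intro avoid[OF Q]) auto
        then show ?thesis by blast
      qed
    qed
  next
    case True
    then obtain a c where ac: "{u, a} \<in> M" "{v, c} \<in> M" "a \<noteq> v" by blast
    have ne: "{u, a} \<noteq> {v, c}"
      using ac \<open>u \<noteq> v\<close> by (auto simp: doubleton_eq_iff)
    have disj: "{u, a} \<inter> {v, c} = {}"
      using matching_unique[OF M ac(1,2)] ne by blast
    have "a \<noteq> u" "c \<noteq> v"
      using matching_not_loop[OF M] ac by auto
    have "a \<in> A" "c \<in> A"
      using M ac by (auto simp: matching_def)
    have fresh: "s \<inter> {a, c} = {}" if "s \<in> ?D" for s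
      using matching_unique[OF M _ ac(1)] matching_unique[OF M _ ac(2)] that by auto
    have "matching ?D (A - {u, v} - {a, c})"
      using D fresh by (auto simp: matching_def)
    then have "matching (insert {a, c} ?D) (A - {u, v} - {a, c} \<union> {a, c})"
      using disj by (intro matching_insert) auto
    then have "matching (insert {a, c} ?D) (A - {u, v})"
      by (rule matching_mono) (use disj \<open>a \<in> A\<close> \<open>c \<in> A\<close> \<open>a \<noteq> u\<close> \<open>c \<noteq> v\<close> in auto)
    then show ?thesis
    proof (rule that)
      fix Q assume Q: "avoids (insert {a, c} ?D) Q"
      then have QD: "avoids ?D Q" and "a \<notin> Q \<or> c \<notin> Q"
        by (auto simp: avoids_def)
      then show "\<exists>w\<in>{u, v}. avoids M (insert w (Q - {u, v}))"
      proof (elim disjE)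
        assume "a \<notin> Q"
        have "avoids M (insert u (Q - {u, v}))"
        proof (rule avoid[OF QD])
          fix p assume "{u, p} \<in> M" "p \<in> Q - {u, v}"
          then show False
            using matching_unique[OF M _ ac(1), of "{u, p}" u] \<open>a \<notin> Q\<close> by (auto simp: doubleton_eq_iff)
        qed auto
        then show ?thesis by blast
      next
        assume "c \<notin> Q"
        have "avoids M (insert v (Q - {u, v}))"
        proof (rule avoid[OF QD])
          fix p assume "{v, p} \<in> M" "p \<in> Q - {u, v}"
          then show False
            using matching_unique[OF M _ ac(2), of "{v, p}" v] \<open>c \<notin> Q\<close> by (auto simp: doubleton_eq_iff)
        qed auto
        then show ?thesis by blast
      qed
    qed
  qed
qed

text \<open>The fresh vertex \<open>z\<close> takes over the partner of \<open>v\<close>, so that a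
  restriction involving \<open>v\<close> survives its removal.\<close>

lemma matching_transfer:
  assumes M: "matching M A" and z: "z \<notin> A"
  obtains M' where "matching M' (insert z (A - {v}))"
    "\<And>s. s \<in> M \<Longrightarrow> v \<notin> s \<Longrightarrow> s \<in> M'" "\<And>p. {v, p} \<in> M \<Longrightarrow> {z, p} \<in> M'"
proof -
  let ?D = "{s \<in> M. s \<inter> {v} = {}}"
  have D: "matching ?D (A - {v})"
    by (rule matching_delete[OF M])
  show ?thesis
  proof (cases "\<exists>p. {v, p} \<in> M")
    case False
    have "matching ?D (insert z (A - {v}))"
      using D by (rule matching_mono) auto
    then show ?thesis
      by (rule that) (use False in auto)
  next
    case True
    then obtain p where p: "{v, p} \<in> M" by blast
    have "p \<noteq> v" "p \<in> A"
      using matching_not_loop[OF M] p M by (auto simp: matching_def)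
    have "s \<inter> {p} = {}" if "s \<in> ?D" for s
      using matching_unique[OF M _ p] that by auto
    then have "matching ?D (A - {v} - {p})"
      using D by (auto simp: matching_def)
    then have "matching (insert {z, p} ?D) (A - {v} - {p} \<union> {z, p})"
      using z \<open>p \<in> A\<close> by (intro matching_insert) auto
    then have m: "matching (insert {z, p} ?D) (insert z (A - {v}))"
      by (rule matching_mono) (use \<open>p \<in> A\<close> \<open>p \<noteq> v\<close> in auto)
    have "q = p" if "{v, q} \<in> M" for q
      using matching_unique[OF M that p, of v] by (auto simp: doubleton_eq_iff)
    then show ?thesis
      by (intro that[OF m]) auto
  qed
qed

text \<open>
  For the bowtie: a monochromatic \<open>y\<close> (with \<open>z\<close> not monochromatic) forces \<open>w\<close> to be monochromatic,
  so the old partner of \<open>w\<close> is paired with \<open>y\<close>, and that of \<open>v\<close> with \<open>z\<close>.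
\<close>

lemma matching_swap2:
  assumes M: "matching M A" and vw: "v \<noteq> w" and vyw: "y \<noteq> v" "y \<noteq> w" and yz: "y \<noteq> z" "y \<notin> A" "z \<notin> A"
  obtains M' where "matching M' (A - {v, w} \<union> {y, z})"
    "\<And>Q. avoids M' Q \<Longrightarrow> avoids M (Q - {v, w})"
    "\<And>Q. avoids M' Q \<Longrightarrow> y \<in> Q \<Longrightarrow> avoids M (insert w (Q - {v, w}))"
    "\<And>Q. avoids M' Q \<Longrightarrow> z \<in> Q \<Longrightarrow> avoids M (insert v (Q - {v, w}))"
proof (cases "{v, w} \<in> M")
  \<comment> \<open>When \<open>v\<close> and \<open>w\<close> are each other's partners, dropping
    their pair is enough, since at most one of them is put back into the set.\<close>
  case True
  let ?D = "{s \<in> M. s \<inter> {v, w} = {}}"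
  have "s = {v, w}" if "s \<in> M" "s \<notin> ?D" for s
    using matching_unique[OF M that(1) True] that by blast
  then have "avoids M Q'" if "avoids ?D Q" "Q' \<subseteq> Q \<union> {v, w}" "\<not> {v, w} \<subseteq> Q'" for Q Q'
    using that unfolding avoids_def by blast
  note * = this
  show ?thesis
  proof (rule that[of ?D])
    show "matching ?D (A - {v, w} \<union> {y, z})"
      using matching_delete[OF M] by (rule matching_mono) auto
    fix Q assume Q: "avoids ?D Q"
    show "avoids M (Q - {v, w})"
      by (rule *[OF Q]) auto
    show "avoids M (insert w (Q - {v, w}))" "avoids M (insert v (Q - {v, w}))"
      by (rule *[OF Q]; use vw in auto)+
  qed
next
  case False
  obtain M1 where M1: "matching M1 (insert y (A - {w}))"
    "\<And>s. s \<in> M \<Longrightarrow> w \<notin> s \<Longrightarrow> s \<in> M1" "\<And>p. {w, p} \<in> M \<Longrightarrow> {y, p} \<in> M1"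
    using matching_transfer[OF M yz(2), of w] by metis
  have "z \<notin> insert y (A - {w})" using yz by auto
  then obtain M2 where M2: "matching M2 (insert z (insert y (A - {w}) - {v}))"
    "\<And>s. s \<in> M1 \<Longrightarrow> v \<notin> s \<Longrightarrow> s \<in> M2" "\<And>p. {v, p} \<in> M1 \<Longrightarrow> {z, p} \<in> M2"
    using matching_transfer[OF M1(1), of z v] by metis
  have keep: "s \<in> M2" if "s \<in> M" "v \<notin> s" "w \<notin> s" for s
    using M1(2) M2(2) that by blast
  \<comment> \<open>Because \<open>{v, w} \<notin> M\<close>, the pair moved to \<open>y\<close>
    does not contain \<open>v\<close> and survives the second transfer.\<close>
  have y: "{y, p} \<in> M2" if "{w, p} \<in> M" for p
    using M1(3)[OF that] M2(2)[of "{y, p}"] that False vyw by (auto simp: insert_commute)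
  have z: "{z, p} \<in> M2" if "{v, p} \<in> M" for p
    using M1(2)[OF that] M2(3)[of p] that False vw by auto
  show ?thesis
  proof (rule that[of M2])
    show "matching M2 (A - {v, w} \<union> {y, z})"
      using M2(1) by (rule matching_mono) auto
    fix Q assume Q: "avoids M2 Q"
    then have no: "\<not> s \<subseteq> Q" if "s \<in> M2" for s
      using that by (auto simp: avoids_def)
    then show *: "avoids M (Q - {v, w})"
      using keep by (auto simp: avoids_def)
    have **: "avoids M (insert u (Q - {v, w}))" if "\<And>p. {u, p} \<in> M \<Longrightarrow> p \<notin> Q" for u
      unfolding avoids_def
    proof (intro ballI notI)
      fix s assume s: "s \<in> M" "s \<subseteq> insert u (Q - {v, w})"
      show False
      proof (cases "u \<in> s")
        case True
        then obtain p where "s = {u, p}" "p \<noteq> u"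
          using matching_partner[OF M s(1)] by metis
        then show False using that[of p] s by auto
      next
        case False
        then show False
          using * s by (auto simp: avoids_def)
      qed
    qed
    show "avoids M (insert w (Q - {v, w}))" if "y \<in> Q"
      using ** [of w] no[OF y] that by blast
    show "avoids M (insert v (Q - {v, w}))" if "z \<in> Q"
      using ** [of v] no[OF z] that by blast
  qed
qed

section \<open>Extending colorings\<close>

text \<open>Only the two degree functions of a coloring are exposed: they decide both which edges
  \<open>lin_insert\<close> can add and which vertices are monochromatic.\<close>

definition realizable :: "'a set set \<Rightarrow> ('a \<Rightarrow> nat) \<Rightarrow> ('a \<Rightarrow> nat) \<Rightarrow> bool" where
  "realizable E r b \<longleftrightarrow> (\<exists>R B. R \<union> B = E \<and> R \<inter> B = {} \<and> lin R \<and> lin B \<and> degree R = r \<and> degree B = b)"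

definition mono_set :: "('a \<Rightarrow> nat) \<Rightarrow> ('a \<Rightarrow> nat) \<Rightarrow> 'a set" where
  "mono_set r b = {v. r v = 2 \<and> b v = 0 \<or> r v = 0 \<and> b v = 2}"

lemma mono_set_swap: "mono_set r b = mono_set b r"
  by (auto simp: mono_set_def)

lemma realizable_swap: "realizable E r b \<longleftrightarrow> realizable E b r"
  unfolding realizable_def by (metis inf_commute sup_commute)

lemma realizable_degree: "realizable E r b \<Longrightarrow> r v + b v = degree E v"
  by (auto simp: realizable_def lin_def degree_Un_disjoint)

lemma realizable_insert:
  assumes "realizable E r b" "{u, v} \<notin> E" "u \<noteq> v" "r v = 0" "r u \<le> 1"
  shows "realizable (insert {u, v} E) (r(u := Suc (r u), v := 1)) b"
proof -
  obtain R B where RB: "R \<union> B = E" "R \<inter> B = {}" "lin R" "lin B" "degree R = r" "degree B = b"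
    using assms(1) by (auto simp: realizable_def)
  have "lin (insert {u, v} R)"
    using assms RB by (intro lin_insert) auto
  moreover have "{u, v} \<notin> R" "finite R"
    using assms RB by (auto simp: lin_def)
  then have "degree (insert {u, v} R) = r(u := Suc (r u), v := 1)"
    using assms RB by (auto simp: degree_insert fun_eq_iff)
  moreover have "insert {u, v} R \<union> B = insert {u, v} E" "insert {u, v} R \<inter> B = {}"
    using assms RB by auto
  ultimately show ?thesis
    unfolding realizable_def using RB by blast
qed

text \<open>
  A script \<open>(k, u, v)\<close> adds the edge \<open>{u, v}\<close> in the first color (\<open>k\<close> true) or the second,
  where \<open>v\<close> must not yet meet that color.
\<close>

fun paint :: "(bool \<times> 'a \<times> 'a) list \<Rightarrow> 'a set set \<Rightarrow> ('a \<Rightarrow> nat) \<Rightarrow> ('a \<Rightarrow> nat) \<Rightarrow>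
    ('a set set \<Rightarrow> ('a \<Rightarrow> nat) \<Rightarrow> ('a \<Rightarrow> nat) \<Rightarrow> bool) \<Rightarrow> bool" where
  "paint [] E r b P \<longleftrightarrow> P E r b"
| "paint ((True, u, v) # L) E r b P \<longleftrightarrow> {u, v} \<notin> E \<and> u \<noteq> v \<and> r v = 0 \<and> r u \<le> 1 \<and>
     paint L (insert {u, v} E) (r(u := Suc (r u), v := 1)) b P"
| "paint ((False, u, v) # L) E r b P \<longleftrightarrow> {u, v} \<notin> E \<and> u \<noteq> v \<and> b v = 0 \<and> b u \<le> 1 \<and>
     paint L (insert {u, v} E) r (b(u := Suc (b u), v := 1)) P"

lemma paint_sound:
  assumes "realizable E r b" "paint L E r b (\<lambda>E' r' b'. E' = E2 \<and> Q \<inter> mono_set r' b' \<subseteq> Q')"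
  shows "\<exists>r' b'. realizable E2 r' b' \<and> Q \<inter> mono_set r' b' \<subseteq> Q'"
  using assms
proof (induction L E r b "\<lambda>E' r' b'. E' = E2 \<and> Q \<inter> mono_set r' b' \<subseteq> Q'" rule: paint.induct)
  case (2 u v L E r b)
  then show ?case
    using realizable_insert[of E r b u v] by simp
next
  case (3 u v L E r b)
  have "realizable (insert {u, v} E) (b(u := Suc (b u), v := 1)) r"
    using 3 by (intro realizable_insert) (auto simp: realizable_swap[of _ r])
  then show ?case
    using 3 by (simp add: realizable_swap[of _ r])
qed auto

section \<open>Extension over a leaf, an edge and the three configurations\<close>

abbreviation (input) extends :: "'a set set \<Rightarrow> 'a set \<Rightarrow> 'a set \<Rightarrow> bool" where
  "extends E2 Q Q' \<equiv> \<exists>r' b'. realizable E2 r' b' \<and> Q \<inter> mono_set r' b' \<subseteq> Q'"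

text \<open>The color occurring less often at \<open>u\<close> has room there, and using it cannot
  make \<open>u\<close> monochromatic.\<close>

lemma extend_leaf:
  assumes "realizable E r b" "{u, v} \<notin> E" "u \<noteq> v" "degree E v = 0" "degree E u \<le> 3"
  shows "extends (insert {u, v} E) UNIV (mono_set r b - {u, v})"
proof -
  have *: "extends (insert {u, v} E) UNIV (mono_set r b - {u, v})"
    if h: "realizable E r b" and le: "r u \<le> b u" for r b
  proof -
    have "r u + b u \<le> 3" "r v = 0" "b v = 0"
      using realizable_degree[OF h, of u] realizable_degree[OF h, of v] assms by auto
    then show ?thesis
      using assms le by (intro paint_sound[OF h, of "[(True, u, v)]"]) (auto simp: mono_set_def split: if_splits)
  qed
  show ?thesis
  proof (cases "r u \<le> b u")
    case False
    then show ?thesis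
      using *[of b r] assms(1) by (simp add: realizable_swap[of _ r] mono_set_swap[of r])
  qed (use * assms in blast)
qed

text \<open>If the old edges at \<open>u\<close> and \<open>v\<close> agree in color, the new edge
  takes the other color; otherwise it takes the color present at \<open>w\<close>, and only
  \<open>w\<close> becomes monochromatic.\<close>

lemma extend_edge:
  assumes "realizable E r b" "{u, v} \<notin> E" "u \<noteq> v" "degree E u = 1" "degree E v = 1" "w \<in> {u, v}"
  shows "extends (insert {u, v} E) UNIV (insert w (mono_set r b - {u, v}))"
proof -
  have *: "extends (insert {u, v} E) UNIV (insert w (mono_set r b - {u, v}))"
    if h: "realizable E r b" and r: "r u = 1" for r b
  proof -
    have d: "r u + b u = 1" "r v + b v = 1"
      using realizable_degree[OF h, of u] realizable_degree[OF h, of v] assms by auto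
    consider "r v = 1" | "r v = 0" "w = u" | "r v = 0" "w = v"
      using d assms(6) by fastforce
    then show ?thesis
    proof cases
      case 1
      show ?thesis
        by (intro paint_sound[OF h, of "[(False, u, v)]"])
          (use d assms r 1 in \<open>auto simp: mono_set_def split: if_splits\<close>)
    next
      case 2
      show ?thesis
        by (intro paint_sound[OF h, of "[(True, u, v)]"])
          (use d assms r 2 in \<open>auto simp: mono_set_def split: if_splits\<close>)
    next
      case 3
      show ?thesis
        by (intro paint_sound[OF h, of "[(False, v, u)]"])
          (use d assms r 3 in \<open>auto simp: mono_set_def insert_commute split: if_splits\<close>)
    qed
  qed
  show ?thesis
  proof (cases "r u = 1")
    case False
    then have "b u = 1"
      using realizable_degree[OF assms(1), of u] assms by auto
    then show ?thesis
      using *[of b r] assms(1) by (simp add: realizable_swap[of _ r] mono_set_swap[of r])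
  qed (use * assms in blast)
qed

text \<open>If one of \<open>x\<close>, \<open>y\<close> is monochromatic, its new edges share the
  other color; the opposite end has room for both colors, so using both there leaves just one of
  \<open>a\<close>, \<open>c\<close> monochromatic, either one by symmetry. If neither is, colors
  alternate around the square.\<close>

lemma extend_square:
  assumes "realizable E r b" and d: "distinct [x, y, a, c]"
    and n: "{x, a} \<notin> E" "{x, c} \<notin> E" "{y, a} \<notin> E" "{y, c} \<notin> E"
    and deg: "degree E a = 0" "degree E c = 0" "degree E x \<le> 2" "degree E y \<le> 2"
    and nm: "x \<notin> mono_set r b \<or> y \<notin> mono_set r b" and w: "w \<in> {a, c}"
  shows "extends (E \<union> {{x, a}, {x, c}, {y, a}, {y, c}}) (- {x, y}) (insert w (mono_set r b - {a, c}))"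
proof -
  let ?E2 = "\<lambda>x y a c. E \<union> {{x, a}, {x, c}, {y, a}, {y, c}}"
  have *: "extends (?E2 x y a c) (- {x, y}) (insert c (mono_set r b - {a, c}))"
    if h: "realizable E r b" and d: "distinct [x, y, a, c]"
      and n: "{x, a} \<notin> E" "{x, c} \<notin> E" "{y, a} \<notin> E" "{y, c} \<notin> E"
      and deg: "degree E a = 0" "degree E c = 0" "degree E x \<le> 2" "degree E y \<le> 2"
      and y: "y \<notin> mono_set r b" and x: "b x \<le> r x" for x y a c r b
  proof -
    have deg': "r a = 0" "b a = 0" "r c = 0" "b c = 0" "r x + b x \<le> 2" "r y + b y \<le> 2"
      using realizable_degree[OF h, of a] realizable_degree[OF h, of c] realizable_degree[OF h, of x]
        realizable_degree[OF h, of y] deg by simp_all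
    then have y1: "r y \<le> 1" "b y \<le> 1"
      using y by (auto simp: mono_set_def)
    consider "r x = 2" "b x = 0" | "r x \<le> 1" "b x \<le> 1"
      using x deg' by linarith
    then show ?thesis
    proof cases
      \<comment> \<open>The path \<open>y\<close>, \<open>c\<close>, \<open>x\<close>,
        \<open>a\<close> of the second color is built starting from \<open>y\<close>, the only one
        of its vertices that may already meet that color. The last edge gives \<open>a\<close> both
        colors.\<close>
      case 1
      show ?thesis
        by (intro paint_sound[OF h, of "[(False, y, c), (False, c, x), (False, x, a), (True, y, a)]"])
          (use d n deg' y1 1 in \<open>auto simp: mono_set_def insert_commute doubleton_eq_iff split: if_splits\<close>)
    next
      case 2
      show ?thesis
        by (intro paint_sound[OF h, of "[(True, x, a), (False, y, a), (False, x, c), (True, y, c)]"])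
          (use d n deg' y1 2 in \<open>auto simp: mono_set_def insert_commute doubleton_eq_iff split: if_splits\<close>)
    qed
  qed
  have **: "extends (?E2 x y a c) (- {x, y}) (insert c (mono_set r b - {a, c}))"
    if h: "realizable E r b" and d: "distinct [x, y, a, c]"
      and n: "{x, a} \<notin> E" "{x, c} \<notin> E" "{y, a} \<notin> E" "{y, c} \<notin> E"
      and deg: "degree E a = 0" "degree E c = 0" "degree E x \<le> 2" "degree E y \<le> 2"
      and y: "y \<notin> mono_set r b" for x y a c r b
  proof (cases "b x \<le> r x")
    case False
    then show ?thesis
      using *[of b r x y a c] that by (simp add: realizable_swap[of _ r] mono_set_swap[of r])
  qed (use * that in blast)
  have ***: "extends (?E2 x y a c) (- {x, y}) (insert c (mono_set r b - {a, c}))"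
    if "distinct [x, y, a, c]" "{x, a} \<notin> E" "{x, c} \<notin> E" "{y, a} \<notin> E" "{y, c} \<notin> E"
      "degree E a = 0" "degree E c = 0" for a c
  proof (cases "y \<in> mono_set r b")
    case True
    then have "x \<notin> mono_set r b" using nm by blast
    then show ?thesis
      using **[of r b y x a c] assms(1) that deg by (auto simp: insert_commute)
  qed (use **[of r b x y a c] assms(1) that deg in auto)
  show ?thesis
    using w ***[of a c] ***[of c a] d n deg by (auto simp: insert_commute)
qed

text \<open>With a single old edge at \<open>x\<close>, one color is still fresh there. This is room
  enough to give \<open>v\<close> both colors whatever the colors at \<open>y\<close>, so no
  condition on \<open>y\<close> is imposed.\<close>

lemma extend_triangle:
  assumes "realizable E r b" and d: "distinct [x, y, v]"
    and n: "{x, y} \<notin> E" "{x, v} \<notin> E" "{y, v} \<notin> E"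
    and deg: "degree E v = 0" "degree E x = 1" "degree E y \<le> 2"
  shows "extends (E \<union> {{x, y}, {x, v}, {y, v}}) (- {x, y}) (mono_set r b - {v})"
proof -
  have *: "extends (E \<union> {{x, y}, {x, v}, {y, v}}) (- {x, y}) (mono_set r b - {v})"
    if h: "realizable E r b" and x: "r x = 1" for r b
  proof -
    have deg': "r v = 0" "b v = 0" "b x = 0" "r y + b y \<le> 2"
      using realizable_degree[OF h, of v] realizable_degree[OF h, of x] realizable_degree[OF h, of y] deg x
      by auto
    consider "r y = 2" "b y = 0" | "r y = 0" "b y = 2" | "r y \<le> 1" "b y \<le> 1"
      using deg' by linarith
    then show ?thesis
    proof cases
      case 1
      show ?thesis
        by (intro paint_sound[OF h, of "[(False, x, y), (False, y, v), (True, x, v)]"])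
          (use d n deg' x 1 in \<open>auto simp: mono_set_def insert_commute doubleton_eq_iff split: if_splits\<close>)
    next
      case 2
      show ?thesis
        by (intro paint_sound[OF h, of "[(True, x, y), (False, x, v), (True, y, v)]"])
          (use d n deg' x 2 in \<open>auto simp: mono_set_def insert_commute doubleton_eq_iff split: if_splits\<close>)
    next
      case 3
      show ?thesis
        by (intro paint_sound[OF h, of "[(False, y, x), (False, x, v), (True, y, v)]"])
          (use d n deg' x 3 in \<open>auto simp: mono_set_def insert_commute doubleton_eq_iff split: if_splits\<close>)
    qed
  qed
  show ?thesis
  proof (cases "r x = 1")
    case False
    then have "b x = 1"
      using realizable_degree[OF assms(1), of x] assms by auto
    then show ?thesis
      using *[of b r] assms(1) by (simp add: realizable_swap[of _ r] mono_set_swap[of r])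
  qed (use * assms in blast)
qed

text \<open>All four edges at \<open>x\<close> are new and must split two and two. Both
  \<open>v\<close> and \<open>w\<close> receive both colors unless exactly one of \<open>y\<close>,
  \<open>z\<close> is monochromatic; then the tip of the other triangle absorbs the
  imbalance.\<close>

lemma extend_bowtie:
  assumes "realizable E r b" and d: "distinct [x, y, z, v, w]"
    and n: "{x, y} \<notin> E" "{x, v} \<notin> E" "{y, v} \<notin> E" "{x, z} \<notin> E" "{x, w} \<notin> E" "{z, w} \<notin> E"
    and deg: "degree E v = 0" "degree E w = 0" "degree E x = 0" "degree E y \<le> 2" "degree E z \<le> 2"
  defines "Q \<equiv> mono_set r b"
  shows "extends (E \<union> {{x, y}, {x, v}, {y, v}, {x, z}, {x, w}, {z, w}}) (- {x, y, z})
    ((if y \<in> Q \<and> z \<notin> Q then {w} else if z \<in> Q \<and> y \<notin> Q then {v} else {}) \<union> (Q - {v, w}))"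
proof -
  let ?E2 = "\<lambda>y v z w. E \<union> {{x, y}, {x, v}, {y, v}, {x, z}, {x, w}, {z, w}}"
  let ?Q = "\<lambda>r b y v z w. ((if y \<in> mono_set r b \<and> z \<notin> mono_set r b then {w}
    else if z \<in> mono_set r b \<and> y \<notin> mono_set r b then {v} else {}) \<union> (mono_set r b - {v, w}))"
  have *: "extends (?E2 y v z w) (- {x, y, z}) (?Q r b y v z w)"
    if h: "realizable E r b" and d: "distinct [x, y, z, v, w]"
      and n: "{x, y} \<notin> E" "{x, v} \<notin> E" "{y, v} \<notin> E" "{x, z} \<notin> E" "{x, w} \<notin> E" "{z, w} \<notin> E"
      and deg: "degree E v = 0" "degree E w = 0" "degree E y \<le> 2" "degree E z \<le> 2"
      and y: "y \<in> mono_set r b \<and> b y \<le> r y \<or> z \<notin> mono_set r b \<and> y \<notin> mono_set r b" for r b y v z w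
  proof -
    have deg': "r v = 0" "b v = 0" "r w = 0" "b w = 0" "r x = 0" "b x = 0" "r y + b y \<le> 2" "r z + b z \<le> 2"
      using realizable_degree[OF h, of v] realizable_degree[OF h, of w] realizable_degree[OF h, of x]
        realizable_degree[OF h, of y] realizable_degree[OF h, of z] deg \<open>degree E x = 0\<close> by simp_all
    have trichotomy: "r u = 2 \<and> b u = 0 \<or> r u = 0 \<and> b u = 2 \<or> r u \<le> 1 \<and> b u \<le> 1"
      if "r u + b u \<le> 2" for u
      using that by linarith
    consider
        "r y \<le> 1" "b y \<le> 1" "r z \<le> 1" "b z \<le> 1"
      | "r y = 2" "b y = 0" "r z \<le> 1" "b z \<le> 1"
      | "r y = 2" "b y = 0" "r z = 2" "b z = 0"
      | "r y = 2" "b y = 0" "r z = 0" "b z = 2"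
      using y trichotomy[OF deg'(7)] trichotomy[OF deg'(8)] by (auto simp: mono_set_def)
    then show ?thesis
    proof cases
      case 1
      show ?thesis
        by (intro paint_sound[OF h, of "[(True, y, x), (True, x, v), (False, y, v), (False, z, x), (False, x, w), (True, z, w)]"])
          (use d n deg' 1 in \<open>auto simp: mono_set_def insert_commute doubleton_eq_iff split: if_splits\<close>)
    next
      \<comment> \<open>Here \<open>{x, y}\<close> and \<open>{y, v}\<close> need the second color,
        hence \<open>{x, v}\<close> the first, to avoid a triangle. If \<open>z\<close> has one old
        edge of each color, \<open>{x, z}\<close> and \<open>{z, w}\<close> differ; were
        \<open>w\<close> to receive both colors, \<open>{x, z}\<close> and \<open>{x, w}\<close>
        would agree and give \<open>x\<close> three edges of one color. So \<open>w\<close> is made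
        monochromatic.\<close>
      case 2
      show ?thesis
        by (intro paint_sound[OF h, of "[(False, z, x), (False, x, y), (False, y, v), (True, z, w), (True, w, x), (True, x, v)]"])
          (use d n deg' 2 in \<open>auto simp: mono_set_def insert_commute doubleton_eq_iff split: if_splits\<close>)
    next
      case 3
      show ?thesis
        by (intro paint_sound[OF h, of "[(False, x, y), (False, y, v), (False, x, z), (False, z, w), (True, x, v), (True, x, w)]"])
          (use d n deg' 3 in \<open>auto simp: mono_set_def insert_commute doubleton_eq_iff split: if_splits\<close>)
    next
      case 4
      show ?thesis
        by (intro paint_sound[OF h, of "[(False, x, y), (False, y, v), (False, x, w), (True, x, z), (True, z, w), (True, x, v)]"])
          (use d n deg' 4 in \<open>auto simp: mono_set_def insert_commute doubleton_eq_iff split: if_splits\<close>)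
    qed
  qed
  have **: "extends (?E2 y v z w) (- {x, y, z}) (?Q r b y v z w)"
    if h: "realizable E r b" and d: "distinct [x, y, z, v, w]"
      and n: "{x, y} \<notin> E" "{x, v} \<notin> E" "{y, v} \<notin> E" "{x, z} \<notin> E" "{x, w} \<notin> E" "{z, w} \<notin> E"
      and deg: "degree E v = 0" "degree E w = 0" "degree E y \<le> 2" "degree E z \<le> 2"
      and y: "y \<in> mono_set r b \<or> z \<notin> mono_set r b \<and> y \<notin> mono_set r b" for y v z w
  proof (cases "b y \<le> r y")
    case True
    then show ?thesis
      using *[OF h d n deg] y by blast
  next
    case False
    have h': "realizable E b r" and sw: "mono_set b r = mono_set r b"
      using h by (simp_all add: realizable_swap[of _ r] mono_set_swap[of r])
    show ?thesis
      using *[OF h' d n deg] y nat_le_linear[of "r y" "b y"] False unfolding sw by blast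
  qed
  show ?thesis
  proof (cases "y \<in> mono_set r b \<or> z \<notin> mono_set r b \<and> y \<notin> mono_set r b")
    case True
    show ?thesis
      unfolding Q_def by (rule **[OF assms(1) d n deg(1,2,4,5) True])
  next
    \<comment> \<open>Only \<open>z\<close> is monochromatic, and the two triangles exchange
      roles.\<close>
    case False
    have "?E2 y v z w = ?E2 z w y v" "- {x, y, z} = - {x, z, y}" "?Q r b y v z w = ?Q r b z w y v"
      using False by auto
    moreover have "extends (?E2 z w y v) (- {x, z, y}) (?Q r b z w y v)"
      by (rule **) (use assms(1) d n deg False in auto)
    ultimately show ?thesis
      unfolding Q_def by simp
  qed
qed

section \<open>The induction\<close>

text \<open>The extension lemmas leave the colors at the hubs of a configuration uncontrolled. This
  does no harm when the hubs do not have degree 2, since only vertices of degree 2 lie in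
  \<open>mono_set\<close>.\<close>

lemma extends_avoids:
  assumes "extends E Q Q'" "{v. degree E v = 2} \<subseteq> Q" "avoids M Q'"
  shows "\<exists>r b. realizable E r b \<and> avoids M (mono_set r b)"
proof -
  obtain r b where rb: "realizable E r b" "Q \<inter> mono_set r b \<subseteq> Q'"
    using assms(1) by blast
  have "mono_set r b \<subseteq> {v. degree E v = 2}"
    using realizable_degree[OF rb(1), symmetric] by (auto simp: mono_set_def)
  then have "mono_set r b \<subseteq> Q'"
    using rb assms(2) by blast
  then show ?thesis
    using rb avoids_mono[OF assms(3)] by blast
qed

lemma realizable_avoiding_exists:
  assumes "finite E" "\<forall>e\<in>E. card e = 2" "width_le_2 E" "\<forall>v. degree E v \<le> 4"
    and "matching M {v. degree E v = 2}"
  shows "\<exists>r b. realizable E r b \<and> avoids M (mono_set r b)"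
  using assms
proof (induction "card E" arbitrary: E M rule: less_induct)
  case less
  note fin = less.prems(1) and card2 = less.prems(2) and deg4 = less.prems(4) and M = less.prems(5)
  \<comment> \<open>One form of the induction hypothesis for all deletions; the pairs can be chosen
    afresh among the vertices of degree 2 in the smaller graph.\<close>
  have IH: "\<exists>r b. realizable (E - X) r b \<and> avoids M' (mono_set r b)"
    if "X \<subseteq> E" "X \<noteq> {}" and m: "matching M' A" "A \<subseteq> {v. degree (E - X) v = 2}" for X M' A
  proof (rule less.hyps)
    show "card (E - X) < card E"
      using that fin by (intro psubset_card_mono) auto
    show "width_le_2 (E - X)"
      using less.prems(3) by (rule width_le_2_mono) auto
    have "degree (E - X) v \<le> degree E v" for v
      using fin by (intro degree_mono) auto
    then show "\<forall>v. degree (E - X) v \<le> 4"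
      using deg4 le_trans by blast
    show "matching M' {v. degree (E - X) v = 2}"
      using m by (rule matching_mono)
  qed (use fin card2 in auto)
  have loop: "{u, u} \<notin> E" for u
    using card2 by auto
  consider (empty) "E = {}" | (leaf) v where "degree E v = 1"
    | (edge) u v where "{u, v} \<in> E" "degree E u = 2" "degree E v = 2"
    | (other) "E \<noteq> {}" "\<forall>v. degree E v \<noteq> 1"
        "\<forall>u v. {u, v} \<in> E \<longrightarrow> \<not> (degree E u = 2 \<and> degree E v = 2)"
    by blast
  then show ?case
  proof cases
    case empty
    have "\<not> is_cycle {} xs" for xs :: "'a list"
      by (cases xs) (auto simp: is_cycle_def)
    then have "realizable E (degree {}) (degree {})"
      using empty by (auto simp: realizable_def lin_def degree_def)
    moreover have "avoids M (mono_set (degree {}) (degree {}))"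
      using M by (auto simp: avoids_def matching_def mono_set_def degree_def)
    ultimately show ?thesis by blast
  next
    case leaf
    then have "{u. {v, u} \<in> E} \<noteq> {}"
      using degree_eq_card_neighbours[OF card2, of v] by (metis card.empty zero_neq_one)
    then obtain u where uv: "{u, v} \<in> E"
      by (auto simp: insert_commute)
    define E' where "E' = E - {{u, v}}"
    have E: "E = insert {u, v} E'" and n: "{u, v} \<notin> E'" and ne: "u \<noteq> v"
      using uv loop by (auto simp: E'_def)
    have "finite E'" using fin by (simp add: E'_def)
    then have d: "degree E w = degree E' w + (if w = u \<or> w = v then 1 else 0)" for w
      using n by (subst E) (auto simp: degree_insert)
    have sub: "{w. degree E w = 2} - {u, v} \<subseteq> {w. degree E' w = 2}"
      using d by auto
    \<comment> \<open>Neither \<open>u\<close> nor \<open>v\<close> becomes monochromatic, so the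
      partners of both are simply released.\<close>
    let ?M = "{s \<in> M. s \<inter> {u, v} = {}}"
    obtain r b where rb: "realizable E' r b" "avoids ?M (mono_set r b)"
      using IH[OF _ _ matching_delete[OF M, of "{u, v}"], of "{{u, v}}"] sub uv
      unfolding E'_def by auto
    have "extends (insert {u, v} E') UNIV (mono_set r b - {u, v})"
      using d[of u] d[of v] leaf deg4[rule_format, of u] by (intro extend_leaf[OF rb(1) n ne]) auto
    then show ?thesis
      using avoids_delete[OF rb(2)] extends_avoids unfolding E[symmetric] by blast
  next
    case edge
    define E' where "E' = E - {{u, v}}"
    have E: "E = insert {u, v} E'" and n: "{u, v} \<notin> E'" and ne: "u \<noteq> v"
      using edge loop by (auto simp: E'_def)
    have "finite E'" using fin by (simp add: E'_def)
    then have d: "degree E w = degree E' w + (if w = u \<or> w = v then 1 else 0)" for w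
      using n by (subst E) (auto simp: degree_insert)
    have sub: "{w. degree E w = 2} - {u, v} \<subseteq> {w. degree E' w = 2}"
      using d by auto
    obtain M' where M': "matching M' ({v. degree E v = 2} - {u, v})"
      "\<And>Q. avoids M' Q \<Longrightarrow> \<exists>w\<in>{u, v}. avoids M (insert w (Q - {u, v}))"
      using matching_delete2[OF M ne] by metis
    obtain r b where rb: "realizable E' r b" "avoids M' (mono_set r b)"
      using IH[OF _ _ M'(1), of "{{u, v}}"] sub edge
      unfolding E'_def by auto
    obtain w where w: "w \<in> {u, v}" "avoids M (insert w (mono_set r b - {u, v}))"
      using M'(2)[OF rb(2)] by blast
    have "extends (insert {u, v} E') UNIV (insert w (mono_set r b - {u, v}))"
      using d[of u] d[of v] edge by (intro extend_edge[OF rb(1) n ne _ _ w(1)]) auto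
    then show ?thesis
      using w(2) extends_avoids unfolding E[symmetric] by blast
  next
    case other
    show ?thesis
    proof (rule width_le_2_configuration[OF fin card2 less.prems(3) other deg4])
      fix x y a c
      assume d: "distinct [x, y, a, c]"
        and e: "{x, a} \<in> E" "{x, c} \<in> E" "{y, a} \<in> E" "{y, c} \<in> E"
        and deg: "degree E a = 2" "degree E c = 2" "3 \<le> degree E x" "3 \<le> degree E y"
      let ?X = "{{x, a}, {x, c}, {y, a}, {y, c}}"
      define E' where "E' = E - ?X"
      have E: "E = insert {x, a} (insert {x, c} (insert {y, a} (insert {y, c} E')))" "E = E' \<union> ?X"
        and n: "{x, a} \<notin> E'" "{x, c} \<notin> E'" "{y, a} \<notin> E'" "{y, c} \<notin> E'"
        using e by (auto simp: E'_def)
      have X: "?X \<subseteq> E" "?X \<noteq> {}" using e by auto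
      note IH' = IH[OF X, folded E'_def]
      have "finite E'" using fin by (simp add: E'_def)
      then have dg: "degree E w = degree E' w + (if w \<in> {x, y, a, c} then 2 else 0)" for w
        using d n by (subst E(1)) (auto simp: degree_insert doubleton_eq_iff)
      obtain M0 where M0: "matching M0 ({v. degree E v = 2} - {a, c})"
        "\<And>Q. avoids M0 Q \<Longrightarrow> \<exists>w\<in>{a, c}. avoids M (insert w (Q - {a, c}))"
        using matching_delete2[OF M, of a c] d by auto
      have sub: "{v. degree E v = 2} - {a, c} \<subseteq> {v. degree E' v = 2}"
        using dg deg by auto
      \<comment> \<open>If both degrees are 4, \<open>x\<close> and \<open>y\<close> drop to degree
        2 and belong to no pair of \<open>M0\<close>, so \<open>{x, y}\<close> can be added.
        Otherwise one of them keeps a single edge and cannot be monochromatic.\<close>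
      have "\<exists>r b. realizable E' r b \<and> avoids M0 (mono_set r b) \<and> (x \<notin> mono_set r b \<or> y \<notin> mono_set r b)"
      proof (cases "degree E x = 4 \<and> degree E y = 4")
        case True
        then have "matching (insert {x, y} M0) (({v. degree E v = 2} - {a, c}) \<union> {x, y})"
          using d by (intro matching_insert[OF M0(1)]) auto
        moreover have "({v. degree E v = 2} - {a, c}) \<union> {x, y} \<subseteq> {v. degree E' v = 2}"
          using sub dg[of x] dg[of y] True by auto
        ultimately obtain r b where "realizable E' r b" "avoids (insert {x, y} M0) (mono_set r b)"
          using IH' by meson
        then show ?thesis
          by (intro exI[of _ r] exI[of _ b]) (simp add: avoids_def)
      next
        case False
        obtain r b where rb: "realizable E' r b" "avoids M0 (mono_set r b)"
          using IH'[OF M0(1) sub] by blast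
        have "degree E' x < 2 \<or> degree E' y < 2"
          using False dg[of x] dg[of y] deg4[rule_format, of x] deg4[rule_format, of y] by auto
        then have "x \<notin> mono_set r b \<or> y \<notin> mono_set r b"
          using realizable_degree[OF rb(1), of x] realizable_degree[OF rb(1), of y]
          by (auto simp: mono_set_def)
        then show ?thesis using rb by blast
      qed
      then obtain r b where rb: "realizable E' r b" "avoids M0 (mono_set r b)"
        and nm: "x \<notin> mono_set r b \<or> y \<notin> mono_set r b" by blast
      obtain w where w: "w \<in> {a, c}" "avoids M (insert w (mono_set r b - {a, c}))"
        using M0(2)[OF rb(2)] by blast
      have "extends (E' \<union> ?X) (- {x, y}) (insert w (mono_set r b - {a, c}))"
        by (rule extend_square[OF rb(1) d n _ _ _ _ nm w(1)])
          (use dg[of a] dg[of c] dg[of x] dg[of y] deg deg4[rule_format, of x] deg4[rule_format, of y] in auto)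
      then show ?thesis
        unfolding E(2)[symmetric] by (rule extends_avoids) (use w deg in auto)
    next
      fix x y v
      assume d: "distinct [x, y, v]" and e: "{x, y} \<in> E" "{x, v} \<in> E" "{y, v} \<in> E"
        and deg: "degree E v = 2" "degree E x = 3" "3 \<le> degree E y"
      let ?X = "{{x, y}, {x, v}, {y, v}}"
      define E' where "E' = E - ?X"
      have E: "E = insert {x, y} (insert {x, v} (insert {y, v} E'))" "E = E' \<union> ?X"
        and n: "{x, y} \<notin> E'" "{x, v} \<notin> E'" "{y, v} \<notin> E'"
        using e by (auto simp: E'_def)
      have X: "?X \<subseteq> E" "?X \<noteq> {}" using e by auto
      note IH' = IH[OF X, folded E'_def]
      have "finite E'" using fin by (simp add: E'_def)
      then have dg: "degree E w = degree E' w + (if w \<in> {x, y, v} then 2 else 0)" for w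
        using d n by (subst E(1)) (auto simp: degree_insert doubleton_eq_iff)
      \<comment> \<open>Since \<open>v\<close> will receive both colors, its partner is released;
        \<open>y\<close> may have dropped to degree 2 but stays unpaired.\<close>
      have "{v. degree E v = 2} - {v} \<subseteq> {v. degree E' v = 2}"
        using dg deg by auto
      then obtain r b where rb: "realizable E' r b" "avoids {s \<in> M. s \<inter> {v} = {}} (mono_set r b)"
        using IH'[OF matching_delete[OF M, of "{v}"]] by meson
      have "extends (E' \<union> ?X) (- {x, y}) (mono_set r b - {v})"
        by (rule extend_triangle[OF rb(1) d n])
          (use dg[of v] dg[of x] dg[of y] deg deg4[rule_format, of y] in auto)
      then show ?thesis
        unfolding E(2)[symmetric] by (rule extends_avoids) (use avoids_delete[OF rb(2)] deg in auto)
    next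
      fix x y z v w
      assume d: "distinct [x, y, z, v, w]" and e: "{x, y} \<in> E" "{x, v} \<in> E" "{y, v} \<in> E"
          "{x, z} \<in> E" "{x, w} \<in> E" "{z, w} \<in> E"
        and deg: "degree E v = 2" "degree E w = 2" "degree E x = 4" "degree E y = 4" "degree E z = 4"
      let ?X = "{{x, y}, {x, v}, {y, v}, {x, z}, {x, w}, {z, w}}"
      define E' where "E' = E - ?X"
      have E: "E = insert {x, y} (insert {x, v} (insert {y, v} (insert {x, z} (insert {x, w} (insert {z, w} E')))))"
          "E = E' \<union> ?X"
        and n: "{x, y} \<notin> E'" "{x, v} \<notin> E'" "{y, v} \<notin> E'" "{x, z} \<notin> E'" "{x, w} \<notin> E'" "{z, w} \<notin> E'"
        using e by (auto simp: E'_def)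
      have X: "?X \<subseteq> E" "?X \<noteq> {}" using e by auto
      note IH' = IH[OF X, folded E'_def]
      have "finite E'" using fin by (simp add: E'_def)
      then have dg: "degree E u = degree E' u + (if u = x then 4 else if u \<in> {y, z, v, w} then 2 else 0)" for u
        using d n by (subst E(1)) (auto simp: degree_insert doubleton_eq_iff)
      obtain M' where M': "matching M' ({v. degree E v = 2} - {v, w} \<union> {y, z})"
        "\<And>Q. avoids M' Q \<Longrightarrow> avoids M (Q - {v, w})"
        "\<And>Q. avoids M' Q \<Longrightarrow> y \<in> Q \<Longrightarrow> avoids M (insert w (Q - {v, w}))"
        "\<And>Q. avoids M' Q \<Longrightarrow> z \<in> Q \<Longrightarrow> avoids M (insert v (Q - {v, w}))"
        using matching_swap2[OF M, of v w y z] d deg by auto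
      \<comment> \<open>Degree 4 in \<open>E\<close> leaves \<open>y\<close> and \<open>z\<close>
        with degree exactly 2, which makes them admissible in pairs.\<close>
      have "{v. degree E v = 2} - {v, w} \<union> {y, z} \<subseteq> {v. degree E' v = 2}"
        using dg deg d by (auto split: if_splits)
      then obtain r b where rb: "realizable E' r b" "avoids M' (mono_set r b)"
        using IH'[OF M'(1)] by meson
      let ?Q = "mono_set r b"
      have "extends (E' \<union> ?X) (- {x, y, z})
        ((if y \<in> ?Q \<and> z \<notin> ?Q then {w} else if z \<in> ?Q \<and> y \<notin> ?Q then {v} else {}) \<union> (?Q - {v, w}))"
        by (rule extend_bowtie[OF rb(1) d n])
          (use d dg[of v] dg[of w] dg[of x] dg[of y] dg[of z] deg in auto)
      then show ?thesis
        unfolding E(2)[symmetric] by (rule extends_avoids) (use M'(2-4)[OF rb(2)] deg in auto)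
    qed
  qed
qed

theorem theorem5:
  fixes V :: "'a set" and E :: "'a set set" and \<S> :: "'a set set"
  assumes "finite V"
    and "simple_graph V E"
    and "partial_2_tree V E"
    and "\<forall>v\<in>V. degree E v \<le> 4"
    and "\<forall>S\<in>\<S>. S \<subseteq> {v \<in> V. degree E v = 2} \<and> card S = 2"
    and "pairwise disjnt \<S>"
  shows "\<exists>c. two_linear_coloring V E c \<and> satisfies E c \<S>"
proof -
  have E: "\<And>e. e \<in> E \<Longrightarrow> e \<subseteq> V" "\<forall>e\<in>E. card e = 2"
    using assms(2) by (auto simp: simple_graph_def)
  have fin: "finite E"
    using E(1) assms(1) by (meson PowI finite_Pow_iff finite_subset subsetI)
  have "degree E v \<le> 4" for v
  proof (cases "v \<in> V")
    case False
    then have "degree E v = 0"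
      using E(1) fin by (auto simp: degree_eq_0_iff)
    then show ?thesis by simp
  qed (use assms(4) in auto)
  moreover have "matching \<S> {v. degree E v = 2}"
    using assms(5,6) by (fastforce simp: matching_def)
  ultimately obtain R B where RB: "R \<union> B = E" "R \<inter> B = {}" "lin R" "lin B"
    and avoid: "avoids \<S> (mono_set (degree R) (degree B))"
    using realizable_avoiding_exists[OF fin E(2) partial_2_tree_imp_width_le_2[OF assms(1,3)]]
    unfolding realizable_def by metis
  define c :: "'a set \<Rightarrow> nat" where "c e = (if e \<in> R then 1 else 2)" for e
  have classes: "{e \<in> E. c e = 1} = R" "{e \<in> E. c e = 2} = B"
    using RB by (auto simp: c_def)
  have "simple_graph V R" "simple_graph V B"
    using assms(2) RB by (auto simp: simple_graph_def)
  then have "two_linear_coloring V E c"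
    unfolding two_linear_coloring_def using classes RB lin_imp_linear_forest[OF assms(1)]
    by (auto simp: c_def)
  moreover have "satisfies E c \<S>"
    unfolding satisfies_def
  proof
    fix S assume S: "S \<in> \<S>"
    \<comment> \<open>Edges of both classes at \<open>v\<close> would have different colors, so all
      of its degree lies in one class.\<close>
    have mono: "v \<in> mono_set (degree R) (degree B)" if v: "monochromatic E c v" for v
    proof -
      have "degree R v + degree B v = 2"
        using v RB degree_Un_disjoint[of R B v] by (auto simp: monochromatic_def lin_def)
      moreover have "degree R v = 0 \<or> degree B v = 0"
      proof (rule ccontr)
        assume "\<not> ?thesis"
        moreover have "finite R" "finite B"
          using RB by (auto simp: lin_def)
        ultimately obtain e f where "e \<in> R" "v \<in> e" "f \<in> B" "v \<in> f"
          by (auto simp: degree_eq_0_iff)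
        moreover from this have "f \<notin> R" "e \<in> E" "f \<in> E"
          using RB by auto
        ultimately have "c e = c f"
          using v unfolding monochromatic_def by blast
        then show False
          using \<open>e \<in> R\<close> \<open>f \<notin> R\<close> by (simp add: c_def)
      qed
      ultimately show ?thesis
        by (auto simp: mono_set_def)
    qed
    have "card S = 2" using assms(5) S by blast
    then have "finite S" by (metis card.infinite zero_neq_numeral)
    moreover have "\<not> S \<subseteq> mono_set (degree R) (degree B)"
      using avoid S by (auto simp: avoids_def)
    then have "{v \<in> S. monochromatic E c v} \<subset> S"
      using mono by blast
    ultimately have "card {v \<in> S. monochromatic E c v} < card S"
      by (simp add: psubset_card_mono)
    then show "card {v \<in> S. monochromatic E c v} \<le> 1"
      using \<open>card S = 2\<close> by simp
  qed
  ultimately show ?thesis by blast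
qed

end
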